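(* Let $T$ be an algebraic torus over an algebraically closed field $k$, with character lattice $\Lambda$, acting on $\mathbb{P}(V)$, $V=k^n$, by $t(x_1:\ldots:x_n)=(\chi_1(t)x_1:\ldots:\chi_n(t)x_n)$ with $\chi_1,\ldots,\chi_n\in\Lambda$. Then the orbit closure $X=\overline{T(1:\ldots:1)}\subset\mathbb{P}(V)$ satisfies the strong separation property (SSP) if and only if $X=\mathbb{P}(V)$ (i.e., the weights $\chi_1,\ldots,\chi_n$ are affinely independent).
   Context: A closed subvariety $Y\subseteq\mathbb{P}(V)$ has the strong separation property (SSP) if for any linear subspace $L\subseteq\mathbb{P}(V)$ of codimension 2 we have $\mathrm{codim}_Y(L\cap Y)=2$. Here linear subspaces of codimension 2 are the $L=\mathbb{P}(W)$ with $W\subseteq V$ a linear subspace of codimension 2 (so $L=\emptyset$ if $\dim V=2$), $\mathrm{codim}_Y(Z)=\dim Y-\dim Z$, and $\dim\emptyset=-1$; this agrees with the corresponding condition for affine cones. Closures are Zariski closures. Affine independence is in $\Lambda\otimes_{\mathbb{Z}}\mathbb{Q}$. *)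

theory Defs
  imports
    "HOL-Analysis.Analysis"
    "HOL-Computational_Algebra.Polynomial"
    "HOL-Library.Poly_Mapping"
    "HOL-Library.FuncSet"
begin

section \<open>Polynomials in the coordinates of affine space\<close>

type_synonym ('k, 'n) mpoly = "('n \<Rightarrow>\<^sub>0 nat) \<Rightarrow>\<^sub>0 'k"

definition mpoly_eval :: "('k::field, 'n::finite) mpoly \<Rightarrow> 'k ^ 'n \<Rightarrow> 'k" where
  "mpoly_eval p x =
     (\<Sum>m\<in>Poly_Mapping.keys p.
        Poly_Mapping.lookup p m * (\<Prod>i\<in>UNIV. (x $ i) ^ Poly_Mapping.lookup m i))"

definition homogeneous :: "('k::field, 'n::finite) mpoly \<Rightarrow> bool" where
  "homogeneous p \<longleftrightarrow>
     (\<exists>d. \<forall>m\<in>Poly_Mapping.keys p. (\<Sum>i\<in>UNIV. Poly_Mapping.lookup m i) = d)"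

section \<open>Projective space and its Zariski topology\<close>

text \<open>The points of the projective space \<open>proj W\<close> of a subspace \<open>W\<close> of \<open>V = k^n\<close> are the lines
  (one-dimensional linear subspaces) in \<open>W\<close>; in particular \<open>proj UNIV\<close> is the whole projective
  space of \<open>V\<close>, and the point with homogeneous coordinates \<open>x\<close> is \<open>vec.span {x}\<close>.\<close>

definition proj :: "('k::field ^ 'n::finite) set \<Rightarrow> ('k ^ 'n) set set" where
  "proj W = {l. vec.subspace l \<and> vec.dim l = 1 \<and> l \<subseteq> W}"

definition vanishing :: "('k::field, 'n::finite) mpoly set \<Rightarrow> ('k ^ 'n) set set" where
  "vanishing S = {l \<in> proj UNIV. \<forall>p\<in>S. \<forall>x\<in>l. mpoly_eval p x = 0}"

definition zariski_closed :: "('k::field ^ 'n::finite) set set \<Rightarrow> bool" where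
  "zariski_closed Z \<longleftrightarrow> (\<exists>S. (\<forall>p\<in>S. homogeneous p) \<and> Z = vanishing S)"

definition zariski :: "('k::field ^ 'n::finite) set topology" where
  "zariski = topology (\<lambda>U. U \<subseteq> proj UNIV \<and> zariski_closed (proj UNIV - U))"

text \<open>The closed sets do form a topology.\<close>

lemma mpoly_eval_superset:
  assumes "finite A" "Poly_Mapping.keys p \<subseteq> A"
  shows "mpoly_eval p x =
     (\<Sum>m\<in>A. Poly_Mapping.lookup p m * (\<Prod>i\<in>UNIV. (x $ i) ^ Poly_Mapping.lookup m i))"
  unfolding mpoly_eval_def
  by (rule sum.mono_neutral_left) (use assms in \<open>auto simp: in_keys_iff\<close>)

lemma mpoly_eval_zero [simp]: "mpoly_eval 0 x = 0"
  by (simp add: mpoly_eval_def)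

lemma mpoly_eval_add: "mpoly_eval (p + q) x = mpoly_eval p x + mpoly_eval q x"
proof -
  let ?A = "Poly_Mapping.keys p \<union> Poly_Mapping.keys q"
  have "finite ?A" by simp
  note e = mpoly_eval_superset[OF this]
  show ?thesis
    using e[of p x] e[of q x] e[of "p + q" x] Poly_Mapping.keys_add[of p q]
    by (simp add: lookup_add distrib_right sum.distrib)
qed

lemma mpoly_eval_sum: "mpoly_eval (\<Sum>a\<in>A. f a) x = (\<Sum>a\<in>A. mpoly_eval (f a) x)"
  by (induction A rule: infinite_finite_induct) (auto simp: mpoly_eval_add)

lemma mpoly_eval_single:
  "mpoly_eval (Poly_Mapping.single m c) x = c * (\<Prod>i\<in>UNIV. (x $ i) ^ Poly_Mapping.lookup m i)"
  by (subst mpoly_eval_superset[of "{m}"]) auto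

lemma mpoly_sum_monomials:
  "(p :: ('k::field, 'n::finite) mpoly)
     = (\<Sum>m\<in>Poly_Mapping.keys p. Poly_Mapping.single m (Poly_Mapping.lookup p m))"
proof (rule poly_mapping_eqI)
  fix k
  show "Poly_Mapping.lookup p k = Poly_Mapping.lookup
     (\<Sum>m\<in>Poly_Mapping.keys p. Poly_Mapping.single m (Poly_Mapping.lookup p m)) k"
    by (cases "k \<in> Poly_Mapping.keys p")
       (auto simp: lookup_sum lookup_single when_def in_keys_iff)
qed

lemma mpoly_eval_mult:
  fixes p q :: "('k::field, 'n::finite) mpoly"
  shows "mpoly_eval (p * q) x = mpoly_eval p x * mpoly_eval q x"
proof -
  let ?M = "\<lambda>m. \<Prod>i\<in>UNIV. (x $ i) ^ Poly_Mapping.lookup m i"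
  have "p * q = (\<Sum>m\<in>Poly_Mapping.keys p. \<Sum>m'\<in>Poly_Mapping.keys q.
      Poly_Mapping.single (m + m') (Poly_Mapping.lookup p m * Poly_Mapping.lookup q m'))"
    by (subst mpoly_sum_monomials[of p], subst mpoly_sum_monomials[of q])
       (simp add: sum_product mult_single)
  then have "mpoly_eval (p * q) x = (\<Sum>m\<in>Poly_Mapping.keys p. \<Sum>m'\<in>Poly_Mapping.keys q.
      (Poly_Mapping.lookup p m * Poly_Mapping.lookup q m') * ?M (m + m'))"
    by (simp add: mpoly_eval_sum mpoly_eval_single)
  also have "\<dots> = (\<Sum>m\<in>Poly_Mapping.keys p. \<Sum>m'\<in>Poly_Mapping.keys q.
      (Poly_Mapping.lookup p m * ?M m) * (Poly_Mapping.lookup q m' * ?M m'))"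
    by (simp add: lookup_add power_add prod.distrib mult_ac)
  also have "\<dots> = mpoly_eval p x * mpoly_eval q x"
    by (simp add: mpoly_eval_def sum_product)
  finally show ?thesis .
qed

lemma homogeneous_mult:
  assumes "homogeneous p" "homogeneous q"
  shows "homogeneous (p * q)"
proof -
  obtain d where d: "\<And>m. m \<in> Poly_Mapping.keys p \<Longrightarrow> (\<Sum>i\<in>UNIV. Poly_Mapping.lookup m i) = d"
    using assms(1) by (auto simp: homogeneous_def)
  obtain e where e: "\<And>m. m \<in> Poly_Mapping.keys q \<Longrightarrow> (\<Sum>i\<in>UNIV. Poly_Mapping.lookup m i) = e"
    using assms(2) by (auto simp: homogeneous_def)
  have "(\<Sum>i\<in>UNIV. Poly_Mapping.lookup m i) = d + e" if m: "m \<in> Poly_Mapping.keys (p * q)" for m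
  proof -
    obtain a b where "a \<in> Poly_Mapping.keys p" "b \<in> Poly_Mapping.keys q" "m = a + b"
      using subsetD[OF keys_mult m] by auto
    then show ?thesis by (simp add: lookup_add sum.distrib d e)
  qed
  then show ?thesis unfolding homogeneous_def by blast
qed

lemma homogeneous_scale:
  assumes "homogeneous p"
  obtains d where "\<And>c x. mpoly_eval p (c *s x) = c ^ d * mpoly_eval p x"
proof -
  obtain d where d: "\<And>m. m \<in> Poly_Mapping.keys p \<Longrightarrow> (\<Sum>i\<in>UNIV. Poly_Mapping.lookup m i) = d"
    using assms by (auto simp: homogeneous_def)
  have "mpoly_eval p (c *s x) = c ^ d * mpoly_eval p x" for c x
    unfolding mpoly_eval_def sum_distrib_left
    by (intro sum.cong refl)
       (simp add: power_mult_distrib prod.distrib d mult_ac flip: power_sum)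
  then show ?thesis by (rule that)
qed

lemma proj_lineE:
  assumes "l \<in> proj W"
  obtains v where "l = vec.span {v}"
proof -
  have "vec.subspace l" "vec.dim l = 1" using assms by (auto simp: proj_def)
  then obtain B where "B \<subseteq> l" "l \<subseteq> vec.span B" "card B = 1"
    by (metis vec.basis_exists)
  moreover then obtain v where "B = {v}" by (auto simp: card_1_singleton_iff)
  ultimately show ?thesis
    using that \<open>vec.subspace l\<close> vec.span_minimal by blast
qed

lemma vanishing_Un:
  assumes "\<forall>p\<in>S. homogeneous p" "\<forall>p\<in>S'. homogeneous p"
  shows "vanishing S \<union> vanishing S' = vanishing {p * q |p q. p \<in> S \<and> q \<in> S'}"
proof
  show "vanishing S \<union> vanishing S' \<subseteq> vanishing {p * q |p q. p \<in> S \<and> q \<in> S'}"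
    by (auto simp: vanishing_def mpoly_eval_mult)
next
  show "vanishing {p * q |p q. p \<in> S \<and> q \<in> S'} \<subseteq> vanishing S \<union> vanishing S'"
  proof (rule subsetI, rule ccontr)
    fix l
    assume l: "l \<in> vanishing {p * q |p q. p \<in> S \<and> q \<in> S'}"
      and n: "l \<notin> vanishing S \<union> vanishing S'"
    have lP: "l \<in> proj UNIV" using l by (simp add: vanishing_def)
    then obtain v where v: "l = vec.span {v}" by (rule proj_lineE)
    obtain p x where p: "p \<in> S" "x \<in> l" "mpoly_eval p x \<noteq> 0"
      using n lP by (auto simp: vanishing_def)
    obtain q y where q: "q \<in> S'" "y \<in> l" "mpoly_eval q y \<noteq> 0"
      using n lP by (auto simp: vanishing_def)
    obtain a where "x = a *s v" using p(2) v by (auto simp: vec.span_singleton)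
    then have "mpoly_eval p v \<noteq> 0"
      using p assms(1) by (metis homogeneous_scale mult_zero_right)
    moreover obtain b where "y = b *s v" using q(2) v by (auto simp: vec.span_singleton)
    then have "mpoly_eval q v \<noteq> 0"
      using q assms(2) by (metis homogeneous_scale mult_zero_right)
    moreover have "v \<in> l" using v by (simp add: vec.span_base)
    then have "mpoly_eval (p * q) v = 0"
      using l p(1) q(1) by (auto simp: vanishing_def)
    ultimately show False by (simp add: mpoly_eval_mult)
  qed
qed

lemma zariski_closed_subset: "zariski_closed Z \<Longrightarrow> Z \<subseteq> proj UNIV"
  by (auto simp: zariski_closed_def vanishing_def)

lemma zariski_closed_Un:
  assumes "zariski_closed Y" "zariski_closed Z"
  shows "zariski_closed (Y \<union> Z)"
proof -
  obtain S S' where S: "\<forall>p\<in>S. homogeneous p" "Y = vanishing S"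
    and S': "\<forall>p\<in>S'. homogeneous p" "Z = vanishing S'"
    using assms by (auto simp: zariski_closed_def)
  show ?thesis
    unfolding zariski_closed_def
    by (rule exI[of _ "{p * q |p q. p \<in> S \<and> q \<in> S'}"])
       (use S S' in \<open>auto simp: vanishing_Un[symmetric] intro: homogeneous_mult\<close>)
qed

lemma zariski_closed_Inter:
  assumes "\<And>Z. Z \<in> \<Z> \<Longrightarrow> zariski_closed Z"
  shows "zariski_closed (proj UNIV \<inter> \<Inter>\<Z>)"
proof -
  obtain S where S: "\<And>Z. Z \<in> \<Z> \<Longrightarrow> (\<forall>p\<in>S Z. homogeneous p) \<and> Z = vanishing (S Z)"
    using assms unfolding zariski_closed_def by metis
  have "proj UNIV \<inter> \<Inter>\<Z> = proj UNIV \<inter> (\<Inter>Z\<in>\<Z>. vanishing (S Z))"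
    using S by auto
  also have "\<dots> = vanishing (\<Union>Z\<in>\<Z>. S Z)"
    by (auto simp: vanishing_def)
  finally show ?thesis
    unfolding zariski_closed_def using S by blast
qed

lemma istopology_zariski:
  "istopology (\<lambda>U. U \<subseteq> proj UNIV \<and> zariski_closed (proj UNIV - U))"
  unfolding istopology_def
proof (intro conjI allI impI)
  fix U U' :: "('k::field ^ 'n::finite) set set"
  assume "U \<subseteq> proj UNIV \<and> zariski_closed (proj UNIV - U)"
    and "U' \<subseteq> proj UNIV \<and> zariski_closed (proj UNIV - U')"
  then show "U \<inter> U' \<subseteq> proj UNIV" "zariski_closed (proj UNIV - U \<inter> U')"
    using zariski_closed_Un by (auto simp: Diff_Int)
next
  fix \<U> :: "('k::field ^ 'n::finite) set set set"
  assume U: "\<forall>U\<in>\<U>. U \<subseteq> proj UNIV \<and> zariski_closed (proj UNIV - U)"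
  then show "\<Union>\<U> \<subseteq> proj UNIV" by blast
  have "zariski_closed (proj UNIV \<inter> \<Inter>((\<lambda>U. proj UNIV - U) ` \<U>))"
    by (rule zariski_closed_Inter) (use U in auto)
  moreover have "proj UNIV \<inter> \<Inter>((\<lambda>U. proj UNIV - U) ` \<U>) = proj UNIV - \<Union>\<U>"
    by auto
  ultimately show "zariski_closed (proj UNIV - \<Union>\<U>)" by simp
qed

lemma openin_zariski:
  "openin zariski U \<longleftrightarrow> U \<subseteq> proj UNIV \<and> zariski_closed (proj UNIV - U)"
  unfolding zariski_def topology_inverse'[OF istopology_zariski] ..

lemma topspace_zariski [simp]:
  "topspace zariski = (proj UNIV :: ('k::field ^ 'n::finite) set set)"
proof -
  have "zariski_closed ({} :: ('k ^ 'n) set set)"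
    unfolding zariski_closed_def
  proof (intro exI[of _ "{1}"] conjI)
    show "\<forall>p\<in>{1 :: ('k, 'n) mpoly}. homogeneous p"
      by (auto simp: homogeneous_def)
    have "mpoly_eval (1 :: ('k, 'n) mpoly) x = 1" for x
      by (simp add: mpoly_eval_single flip: single_one)
    moreover have "0 \<in> l" if "l \<in> proj UNIV" for l :: "('k ^ 'n) set"
      using that by (auto simp: proj_def vec.subspace_0)
    ultimately show "{} = vanishing {1 :: ('k, 'n) mpoly}"
      by (auto simp: vanishing_def)
  qed
  then have "openin zariski (proj UNIV :: ('k ^ 'n) set set)"
    by (simp add: openin_zariski)
  then show ?thesis
    by (metis openin_subset openin_topspace openin_zariski subset_antisym)
qed

lemma closedin_zariski: "closedin zariski Z \<longleftrightarrow> zariski_closed Z"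
  using zariski_closed_subset
  by (auto simp: closedin_def openin_zariski double_diff)

section \<open>Dimension and the strong separation property\<close>

definition irreducible_in :: "'a topology \<Rightarrow> 'a set \<Rightarrow> bool" where
  "irreducible_in X Z \<longleftrightarrow> Z \<subseteq> topspace X \<and> Z \<noteq> {} \<and>
     (\<forall>A B. closedin X A \<longrightarrow> closedin X B \<longrightarrow> Z \<subseteq> A \<union> B \<longrightarrow> Z \<subseteq> A \<or> Z \<subseteq> B)"

text \<open>Krull dimension: the supremum of the lengths \<open>m\<close> of chains \<open>C 0 \<subset> \<dots> \<subset> C m\<close> of irreducible
  closed subsets. The empty space has dimension \<open>-1\<close>.\<close>

definition krull_dim :: "'a topology \<Rightarrow> ereal" where
  "krull_dim X = (if topspace X = {} then -1 else
     Sup {ereal (real m) | m. \<exists>C :: nat \<Rightarrow> 'a set.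
       (\<forall>i\<le>m. closedin X (C i) \<and> irreducible_in X (C i)) \<and> (\<forall>i<m. C i \<subset> C (Suc i))})"

definition zdim :: "('k::field ^ 'n::finite) set set \<Rightarrow> ereal" where
  "zdim Z = krull_dim (subtopology zariski Z)"

definition codim_in :: "('k::field ^ 'n::finite) set set \<Rightarrow> ('k ^ 'n) set set \<Rightarrow> ereal" where
  "codim_in Y Z = zdim Y - zdim Z"

definition strong_separation :: "('k::field ^ 'n::finite) set set \<Rightarrow> bool" where
  "strong_separation Y \<longleftrightarrow>
     (\<forall>W. vec.subspace W \<and> vec.dim W + 2 = CARD('n) \<longrightarrow> codim_in Y (proj W \<inter> Y) = 2)"

section \<open>Tori, characters and orbit closures\<close>

text \<open>The torus of rank \<open>r\<close> is \<open>(k\<^sup>\<times>)\<^sup>r\<close>. Its character lattice is \<open>\<int>\<^sup>r\<close>, where \<open>a\<close> stands for the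
  character sending \<open>t\<close> to the Laurent monomial in \<open>t\<close> with exponents \<open>a\<close>.\<close>

definition torus :: "nat \<Rightarrow> (nat \<Rightarrow> 'k::field) set" where
  "torus r = {..<r} \<rightarrow>\<^sub>E (UNIV - {0})"

definition char_lattice :: "nat \<Rightarrow> (nat \<Rightarrow> int) set" where
  "char_lattice r = {..<r} \<rightarrow>\<^sub>E UNIV"

definition char_eval :: "nat \<Rightarrow> (nat \<Rightarrow> int) \<Rightarrow> (nat \<Rightarrow> 'k::field) \<Rightarrow> 'k" where
  "char_eval r a t = (\<Prod>j<r. t j powi a j)"

definition torus_act ::
    "nat \<Rightarrow> ('n::finite \<Rightarrow> nat \<Rightarrow> int) \<Rightarrow> (nat \<Rightarrow> 'k::field) \<Rightarrow> ('k ^ 'n) set \<Rightarrow> ('k ^ 'n) set" where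
  "torus_act r w t l = (\<lambda>x. \<chi> i. char_eval r (w i) t * x $ i) ` l"

definition orbit_closure :: "nat \<Rightarrow> ('n::finite \<Rightarrow> nat \<Rightarrow> int) \<Rightarrow> ('k::field ^ 'n) set set" where
  "orbit_closure r w = zariski closure_of {torus_act r w t (vec.span {\<chi> i. 1}) | t. t \<in> torus r}"

text \<open>Affine independence of a family of characters (so repeated characters are dependent) in
  \<open>\<int>\<^sup>r \<otimes> \<rat> = \<rat>\<^sup>r\<close>.\<close>

definition affinely_independent :: "nat \<Rightarrow> ('n::finite \<Rightarrow> nat \<Rightarrow> int) \<Rightarrow> bool" where
  "affinely_independent r w \<longleftrightarrow>
     (\<forall>c :: 'n \<Rightarrow> rat.
        (\<Sum>i\<in>UNIV. c i) = 0 \<and> (\<forall>j<r. (\<Sum>i\<in>UNIV. c i * of_int (w i j)) = 0) \<longrightarrow> (\<forall>i. c i = 0))"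

end

(* The dimension of a closed set is bounded through its Hilbert function: a chain of m + 1 irreducible
   closed sets yields (q + m choose m) independent forms of degree q E on its largest member. On the
   torus orbit the monomials of degree d restrict to at most O(d^(rho - 1)) different functions, where
   rho is the dimension of the space A of rational affine functions on the weights. In the other
   direction, a nonnegative function g in A with maximal zero set cuts out a facet, on which the affine
   functions lose one dimension, and the orbit closure of the facet is a proper closed subset. Iterating
   this gives chains of length rho - 1, so dim X = rho - 1, and X is the whole space iff rho = n.
   If the weights are dependent, some facet misses two weights i and j: otherwise A would contain all
   coordinate functions. Then the subspace x_i = x_j = 0 contains the orbit closure of that facet,
   a divisor of X, and (SSP) fails. *)

theory Submission
  imports Defs
begin

section \<open>Forms of fixed degree, Zariski closures, and irreducibility tested on forms\<close>

section \<open>Forms and closed sets\<close>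

text \<open>Krull dimension is given by chains alone, so the upper bound must come from the chain
  itself; counting forms takes the place of transcendence degrees and the principal ideal theorem.
  The binomial coefficient comes from Pascal's rule: let f be a form of degree E that vanishes on Y
  but not on the next larger member Z. Forms of degree (q + 1) E independent on Y, together with f
  times forms of degree q E independent on Z, are independent on Z, because Z is irreducible. On the
  torus side the exponent is rho - 1 instead of rho because A contains the constant 1, whose pairing
  with a monomial is the fixed degree. Both existence claims, chains and failure of (SSP), need
  faces of codimension one, hence an extreme ray of the cone of nonnegative functions in A. The
  weights may be negative; a common shift, invisible in projective space, turns characters into
  monomials, so that curves in the torus give polynomial curves in V.\<close>

definition form :: "nat \<Rightarrow> ('k::field, 'n::finite) mpoly \<Rightarrow> bool" where
  "form d p \<longleftrightarrow> (\<forall>m\<in>Poly_Mapping.keys p. (\<Sum>i\<in>UNIV. Poly_Mapping.lookup m i) = d)"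

lemma homogeneous_iff_form: "homogeneous p \<longleftrightarrow> (\<exists>d. form d p)"
  by (simp add: homogeneous_def form_def)

lemma form_mult:
  assumes "form d p" "form e q"
  shows "form (d + e) (p * q)"
  unfolding form_def
proof
  fix m assume m: "m \<in> Poly_Mapping.keys (p * q)"
  obtain a b where "a \<in> Poly_Mapping.keys p" "b \<in> Poly_Mapping.keys q" "m = a + b"
    using subsetD[OF keys_mult m] by auto
  then show "(\<Sum>i\<in>UNIV. Poly_Mapping.lookup m i) = d + e"
    using assms by (simp add: form_def lookup_add sum.distrib)
qed

lemma form_0 [simp]: "form d 0"
  by (simp add: form_def)

lemma form_add: "form d p \<Longrightarrow> form d q \<Longrightarrow> form d (p + q)"
  using Poly_Mapping.keys_add[of p q] by (auto simp: form_def)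

lemma form_sum: "(\<And>a. a \<in> A \<Longrightarrow> form d (f a)) \<Longrightarrow> form d (\<Sum>a\<in>A. f a)"
  by (induction A rule: infinite_finite_induct) (auto intro: form_add)

lemma form_single: "(\<Sum>i\<in>UNIV. Poly_Mapping.lookup m i) = d \<Longrightarrow> form d (Poly_Mapping.single m c)"
  by (simp add: form_def)

definition scaled :: "'k \<Rightarrow> ('k::field, 'n::finite) mpoly \<Rightarrow> ('k, 'n) mpoly" where
  "scaled c p = Poly_Mapping.single 0 c * p"

lemma mpoly_eval_scaled [simp]: "mpoly_eval (scaled c p) x = c * mpoly_eval p x"
  by (simp add: scaled_def mpoly_eval_mult mpoly_eval_single)

lemma form_scaled: "form d p \<Longrightarrow> form d (scaled c p)"
  using form_mult[OF form_single, of 0 0 d p c] by (simp add: scaled_def)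

definition coord_pow :: "'n \<Rightarrow> nat \<Rightarrow> ('k::field, 'n::finite) mpoly" where
  "coord_pow i e = Poly_Mapping.single (Poly_Mapping.single i e) 1"

lemma mpoly_eval_coord_pow [simp]: "mpoly_eval (coord_pow i e) x = (x $ i) ^ e"
proof -
  have "mpoly_eval (coord_pow i e) x = (\<Prod>j\<in>UNIV. if j = i then (x $ i) ^ e else 1)"
    unfolding coord_pow_def mpoly_eval_single mult_1
    by (rule prod.cong) (auto simp: lookup_single when_def)
  then show ?thesis by simp
qed

lemma form_coord_pow [simp]: "form e (coord_pow i e)"
proof -
  have "(\<Sum>j\<in>UNIV. Poly_Mapping.lookup (Poly_Mapping.single i e) j) = (\<Sum>j\<in>UNIV. if j = i then e else 0)"
    by (rule sum.cong) (auto simp: lookup_single when_def)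
  then show ?thesis unfolding coord_pow_def by (intro form_single) simp
qed

definition linear_form :: "('n \<Rightarrow> 'k) \<Rightarrow> ('k::field, 'n::finite) mpoly" where
  "linear_form c = (\<Sum>i\<in>UNIV. scaled (c i) (coord_pow i 1))"

lemma mpoly_eval_linear_form [simp]: "mpoly_eval (linear_form c) x = (\<Sum>i\<in>UNIV. c i * x $ i)"
  by (simp add: linear_form_def mpoly_eval_sum)

lemma homogeneous_linear_form [simp]: "homogeneous (linear_form c)"
  unfolding homogeneous_iff_form linear_form_def
  by (intro exI[of _ 1] form_sum form_scaled form_coord_pow)

lemma mpoly_eval_scale_eq_0:
  assumes "homogeneous p" "mpoly_eval p x = 0"
  shows "mpoly_eval p (c *s x) = 0"
  using assms by (metis homogeneous_scale mult_zero_right)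

lemma span_singleton_proj: "x \<noteq> 0 \<Longrightarrow> vec.span {x} \<in> proj UNIV"
  by (simp add: proj_def)

lemma span_singleton_scale:
  fixes x y :: "'k::field ^ 'n::finite"
  assumes "c \<noteq> 0" shows "vec.span {c *s x} = vec.span {x}"
proof -
  have "k *s x \<in> range (\<lambda>k. k *s (c *s x))" for k
    using assms by (intro image_eqI[of _ _ "k / c"]) (auto simp: vec_eq_iff)
  then show ?thesis
    unfolding vec.span_singleton by auto
qed

definition vanishes_on :: "('k::field, 'n::finite) mpoly \<Rightarrow> ('k ^ 'n) set set \<Rightarrow> bool" where
  "vanishes_on p Z \<longleftrightarrow> (\<forall>l\<in>Z. \<forall>x\<in>l. mpoly_eval p x = 0)"

lemma vanishes_on_span:
  assumes "homogeneous p"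
  shows "vanishes_on p {vec.span {x}} \<longleftrightarrow> mpoly_eval p x = 0"
  using assms mpoly_eval_scale_eq_0[OF assms]
  by (auto simp: vanishes_on_def vec.span_singleton dest: bspec[of _ _ "x"] intro: vec.span_base)
    (metis rangeI vec.scale_one)

lemma vanishes_on_image_span:
  assumes "homogeneous p"
  shows "vanishes_on p {vec.span {f t} |t. t \<in> D} \<longleftrightarrow> (\<forall>t\<in>D. mpoly_eval p (f t) = 0)"
  using vanishes_on_span[OF assms] by (fastforce simp: vanishes_on_def)

lemma vanishes_on_mono: "vanishes_on p Z \<Longrightarrow> Y \<subseteq> Z \<Longrightarrow> vanishes_on p Y"
  by (auto simp: vanishes_on_def)

lemma proj_point:
  assumes "l \<in> proj W"
  obtains v where "v \<noteq> 0" "v \<in> W" "l = vec.span {v}"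
proof -
  obtain v where v: "l = vec.span {v}" using assms by (rule proj_lineE)
  then have "v \<noteq> 0" using assms by (auto simp: proj_def)
  moreover have "v \<in> W" using v assms by (auto simp: proj_def intro: vec.span_base)
  ultimately show ?thesis using v that by blast
qed

lemma zariski_closed_vanishing:
  "(\<And>p. p \<in> S \<Longrightarrow> homogeneous p) \<Longrightarrow> zariski_closed (vanishing S)"
  by (auto simp: zariski_closed_def)

lemma zariski_closed_hypersurface:
  "homogeneous p \<Longrightarrow> zariski_closed (vanishing {p})"
  by (rule zariski_closed_vanishing) auto

lemma mem_vanishing: "l \<in> vanishing S \<longleftrightarrow> l \<in> proj UNIV \<and> (\<forall>p\<in>S. vanishes_on p {l})"
  by (simp add: vanishing_def vanishes_on_def)

text \<open>The forms that cut out the closure vanish on \<open>S\<close>, so they are among the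
  forms on the right-hand side.\<close>

lemma zariski_closure_of_eq:
  assumes "S \<subseteq> proj UNIV"
  shows "zariski closure_of S = vanishing {p. homogeneous p \<and> vanishes_on p S}"
    (is "_ = ?C")
proof
  show "zariski closure_of S \<subseteq> ?C"
    by (rule closure_of_minimal)
      (use assms in \<open>auto simp: closedin_zariski mem_vanishing vanishes_on_def intro: zariski_closed_vanishing\<close>)
  obtain T where T: "\<forall>p\<in>T. homogeneous p" "zariski closure_of S = vanishing T"
    using closedin_closure_of[of zariski S] unfolding closedin_zariski zariski_closed_def by blast
  have "S \<subseteq> vanishing T" using closure_of_subset[of S zariski] assms T by simp
  then have "T \<subseteq> {p. homogeneous p \<and> vanishes_on p S}"
    using T(1) by (auto simp: vanishing_def vanishes_on_def)
  then show "?C \<subseteq> zariski closure_of S" unfolding T(2) by (auto simp: vanishing_def)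
qed

lemma vanishes_on_closure_of:
  assumes "S \<subseteq> proj UNIV" "homogeneous p"
  shows "vanishes_on p (zariski closure_of S) \<longleftrightarrow> vanishes_on p S"
proof
  assume "vanishes_on p (zariski closure_of S)"
  then show "vanishes_on p S"
    using closure_of_subset[of S zariski] assms vanishes_on_mono by (metis topspace_zariski)
next
  assume "vanishes_on p S"
  then show "vanishes_on p (zariski closure_of S)"
    using assms by (auto simp: zariski_closure_of_eq vanishing_def vanishes_on_def)
qed

lemma zariski_closed_separate:
  assumes "zariski_closed Z" "l \<in> proj UNIV" "l \<notin> Z"
  obtains p where "homogeneous p" "vanishes_on p Z" "\<not> vanishes_on p {l}"
  using assms by (auto simp: zariski_closed_def vanishing_def vanishes_on_def)

lemma irreducible_in_closure_of:
  assumes "irreducible_in T S"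
  shows "irreducible_in T (T closure_of S)"
  using assms closure_of_subset[of S T] closure_of_subset_topspace[of T S]
  unfolding irreducible_in_def
  by (metis closure_of_minimal subset_empty subset_trans)

text \<open>Primality of the homogeneous ideal of \<open>S\<close>. A point of \<open>S\<close>
  outside a closed set is witnessed by one form, so a covering by two closed sets that each miss a
  point of \<open>S\<close> yields two forms whose product vanishes on \<open>S\<close>.\<close>

lemma irreducible_in_zariskiI:
  assumes S: "S \<subseteq> proj UNIV" "S \<noteq> {}"
    and pq: "\<And>p q. \<lbrakk>homogeneous p; homogeneous q; \<not> vanishes_on p S; \<not> vanishes_on q S\<rbrakk>
      \<Longrightarrow> \<not> vanishes_on (p * q) S"
  shows "irreducible_in zariski S"
  unfolding irreducible_in_def
proof (intro conjI allI impI)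
  fix A B assume AB: "closedin zariski A" "closedin zariski B" "S \<subseteq> A \<union> B"
  show "S \<subseteq> A \<or> S \<subseteq> B"
  proof (rule ccontr)
    assume "\<not> ?thesis"
    then obtain a b where a: "a \<in> S" "a \<notin> A" and b: "b \<in> S" "b \<notin> B" by blast
    obtain p where p: "homogeneous p" "vanishes_on p A" "\<not> vanishes_on p {a}"
      using zariski_closed_separate a AB(1) S(1) by (metis closedin_zariski subsetD)
    obtain q where q: "homogeneous q" "vanishes_on q B" "\<not> vanishes_on q {b}"
      using zariski_closed_separate b AB(2) S(1) by (metis closedin_zariski subsetD)
    have "\<not> vanishes_on p S" "\<not> vanishes_on q S"
      using p(3) q(3) a b vanishes_on_mono by blast+
    moreover have "vanishes_on (p * q) S"
      using p(2) q(2) AB(3) by (auto simp: vanishes_on_def mpoly_eval_mult)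
    ultimately show False using pq p(1) q(1) by blast
  qed
qed (use S in auto)

text \<open>The two hypersurfaces cover \<open>Z\<close>: on each line the product is tested at one
  spanning vector, and a field has no zero divisors.\<close>

lemma irreducible_vanishes_mult:
  assumes Z: "irreducible_in zariski Z" and hom: "homogeneous p" "homogeneous q"
    and pq: "vanishes_on (p * q) Z"
  shows "vanishes_on p Z \<or> vanishes_on q Z"
proof -
  have sub: "Z \<subseteq> proj UNIV" using Z by (simp add: irreducible_in_def)
  have "Z \<subseteq> vanishing {p} \<union> vanishing {q}"
  proof
    fix l assume l: "l \<in> Z"
    then obtain v where v: "l = vec.span {v}" using sub proj_point by blast
    then have "mpoly_eval p v * mpoly_eval q v = 0"
      using pq l vec.span_base[of v "{v}"] by (auto simp: vanishes_on_def mpoly_eval_mult)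
    then have "vanishes_on p {l} \<or> vanishes_on q {l}"
      using vanishes_on_span hom v by auto
    then show "l \<in> vanishing {p} \<union> vanishing {q}" using l sub by (auto simp: mem_vanishing)
  qed
  then have "Z \<subseteq> vanishing {p} \<or> Z \<subseteq> vanishing {q}"
    using Z zariski_closed_hypersurface hom unfolding irreducible_in_def closedin_zariski by blast
  then show ?thesis by (auto simp: vanishing_def vanishes_on_def)
qed

section \<open>Krull dimension through chains in the ambient projective space\<close>

section \<open>Chains of irreducible closed sets\<close>

text \<open>\<open>Z\<close> is the largest member and the recursion peels it off, so an induction
  on the length can step from \<open>Z\<close> to a smaller irreducible closed set.\<close>

fun chain_below :: "nat \<Rightarrow> ('k::field ^ 'n::finite) set set \<Rightarrow> bool" where
  "chain_below 0 Z \<longleftrightarrow> zariski_closed Z \<and> irreducible_in zariski Z"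
| "chain_below (Suc m) Z \<longleftrightarrow> zariski_closed Z \<and> irreducible_in zariski Z \<and> (\<exists>Y. Y \<subset> Z \<and> chain_below m Y)"

lemma chain_belowD: "chain_below m Z \<Longrightarrow> zariski_closed Z \<and> irreducible_in zariski Z"
  by (cases m) auto

lemma chain_below_iff:
  "chain_below m Z \<longleftrightarrow> (\<exists>C. (\<forall>i\<le>m. zariski_closed (C i) \<and> irreducible_in zariski (C i)) \<and>
     (\<forall>i<m. C i \<subset> C (Suc i)) \<and> C m = Z)"
proof
  show "chain_below m Z \<Longrightarrow> \<exists>C. (\<forall>i\<le>m. zariski_closed (C i) \<and> irreducible_in zariski (C i)) \<and>
     (\<forall>i<m. C i \<subset> C (Suc i)) \<and> C m = Z"
  proof (induction m arbitrary: Z)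
    case 0
    then show ?case by (intro exI[of _ "\<lambda>_. Z"]) auto
  next
    case (Suc m)
    then obtain Y where Y: "Y \<subset> Z" "chain_below m Y" by auto
    from Suc.IH[OF Y(2)] obtain C where
      C: "\<forall>i\<le>m. zariski_closed (C i) \<and> irreducible_in zariski (C i)"
        "\<forall>i<m. C i \<subset> C (Suc i)" "C m = Y" by blast
    have "i \<le> m \<or> i = Suc m" if "i \<le> Suc m" for i using that by auto
    moreover have "i < m \<or> i = m" if "i < Suc m" for i using that by auto
    ultimately show ?case
      using C Y(1) Suc.prems by (intro exI[of _ "C(Suc m := Z)"]) (auto simp: le_Suc_eq less_Suc_eq)
  qed
next
  assume "\<exists>C. (\<forall>i\<le>m. zariski_closed (C i) \<and> irreducible_in zariski (C i)) \<and>
     (\<forall>i<m. C i \<subset> C (Suc i)) \<and> C m = Z"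
  then obtain C where C: "\<forall>i\<le>m. zariski_closed (C i) \<and> irreducible_in zariski (C i)"
     "\<forall>i<m. C i \<subset> C (Suc i)" "C m = Z" by blast
  have "i \<le> m \<Longrightarrow> chain_below i (C i)" for i
  proof (induction i)
    case 0
    then show ?case using C(1) by simp
  next
    case (Suc i)
    then have "C i \<subset> C (Suc i)" "chain_below i (C i)" using C(2) by simp_all
    then show ?case using C(1) Suc.prems by (simp, blast)
  qed
  then show "chain_below m Z" using C by auto
qed

text \<open>The chains of \<open>zdim\<close> live in a subspace topology; this moves them to the
  ambient one, where chains inside different sets can be compared.\<close>

lemma irreducible_in_subtopology:
  assumes "closedin T Y"
  shows "closedin (subtopology T Y) Z \<and> irreducible_in (subtopology T Y) Z \<longleftrightarrow>
    closedin T Z \<and> irreducible_in T Z \<and> Z \<subseteq> Y"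
proof -
  have Y: "Y \<subseteq> topspace T" using assms by (rule closedin_subset)
  have "irreducible_in (subtopology T Y) Z \<longleftrightarrow> irreducible_in T Z" if ZY: "Z \<subseteq> Y"
  proof
    assume Z: "irreducible_in (subtopology T Y) Z"
    show "irreducible_in T Z"
      unfolding irreducible_in_def
    proof (intro conjI allI impI)
      show "Z \<subseteq> topspace T" "Z \<noteq> {}" using Z by (auto simp: irreducible_in_def)
      fix A B assume "closedin T A" "closedin T B" "Z \<subseteq> A \<union> B"
      then have "closedin (subtopology T Y) (Y \<inter> A)" "closedin (subtopology T Y) (Y \<inter> B)"
        "Z \<subseteq> (Y \<inter> A) \<union> (Y \<inter> B)"
        using ZY by (auto simp: closedin_subtopology)
      then have "Z \<subseteq> Y \<inter> A \<or> Z \<subseteq> Y \<inter> B" using Z unfolding irreducible_in_def by blast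
      then show "Z \<subseteq> A \<or> Z \<subseteq> B" by blast
    qed
  next
    assume "irreducible_in T Z"
    then show "irreducible_in (subtopology T Y) Z"
      using ZY Y closedin_closed_subtopology[OF assms] unfolding irreducible_in_def
      by (simp add: Int_absorb1)
  qed
  moreover have "closedin (subtopology T Y) Z \<longleftrightarrow> closedin T Z \<and> Z \<subseteq> Y"
    using assms by (rule closedin_closed_subtopology)
  ultimately show ?thesis by blast
qed

lemma zdim_eq_Sup_chains:
  assumes "zariski_closed Y" "Y \<noteq> {}"
  shows "zdim Y = Sup {ereal (real m) |m. \<exists>Z\<subseteq>Y. chain_below m Z}"
proof -
  have "topspace (subtopology zariski Y) \<noteq> {}"
    using assms zariski_closed_subset[OF assms(1)] by (auto simp: topspace_subtopology)
  moreover have "(\<exists>C. (\<forall>i\<le>m. closedin (subtopology zariski Y) (C i) \<and> irreducible_in (subtopology zariski Y) (C i))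
      \<and> (\<forall>i<m. C i \<subset> C (Suc i))) \<longleftrightarrow> (\<exists>Z\<subseteq>Y. chain_below m Z)" for m
  proof -
    \<comment> \<open>All members lie in \<open>Y\<close> as soon as the last one does, because the
      chain ascends.\<close>
    have C: "(\<forall>i\<le>m. closedin (subtopology zariski Y) (C i) \<and> irreducible_in (subtopology zariski Y) (C i))
      \<longleftrightarrow> (\<forall>i\<le>m. zariski_closed (C i) \<and> irreducible_in zariski (C i)) \<and> C m \<subseteq> Y"
      if up: "\<forall>i<m. C i \<subset> C (Suc i)" for C
    proof -
      have "C i \<subseteq> C m" if "i \<le> m" for i
        using that by (induction rule: inc_induct) (use up in auto)
      then show ?thesis
        using irreducible_in_subtopology[of zariski Y] assms(1) by (auto simp: closedin_zariski)
    qed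
    have "(\<exists>Z\<subseteq>Y. chain_below m Z) \<longleftrightarrow>
      (\<exists>C. ((\<forall>i\<le>m. zariski_closed (C i) \<and> irreducible_in zariski (C i)) \<and> C m \<subseteq> Y) \<and>
        (\<forall>i<m. C i \<subset> C (Suc i)))"
      unfolding chain_below_iff by blast
    also have "\<dots> \<longleftrightarrow> (\<exists>C. (\<forall>i\<le>m. closedin (subtopology zariski Y) (C i) \<and> irreducible_in (subtopology zariski Y) (C i))
      \<and> (\<forall>i<m. C i \<subset> C (Suc i)))"
      by (intro ex_cong1) (use C in blast)
    finally show ?thesis by simp
  qed
  ultimately show ?thesis unfolding zdim_def krull_dim_def by simp
qed

lemma zdim_empty: "zdim {} = -1"
  by (simp add: zdim_def krull_dim_def)

lemma zdim_ge:
  assumes "zariski_closed Y" "chain_below m Z" "Z \<subseteq> Y"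
  shows "zdim Y \<ge> ereal (real m)"
proof -
  have "Y \<noteq> {}" using assms chain_belowD by (auto simp: irreducible_in_def)
  then show ?thesis
    unfolding zdim_eq_Sup_chains[OF assms(1) \<open>Y \<noteq> {}\<close>] using assms by (intro Sup_upper) auto
qed

lemma zdim_le:
  assumes "zariski_closed Y" "Y \<noteq> {}" "\<And>m Z. chain_below m Z \<Longrightarrow> Z \<subseteq> Y \<Longrightarrow> m \<le> s"
  shows "zdim Y \<le> ereal (real s)"
  unfolding zdim_eq_Sup_chains[OF assms(1,2)] using assms(3) by (intro Sup_least) auto

section \<open>Lower bound for the Hilbert function of the top of a chain\<close>

section \<open>Independent forms along a chain\<close>

text \<open>Linear independence modulo the ideal of \<open>Z\<close>: for forms of one degree,
  \<open>N\<close> is a lower bound for the Hilbert function of \<open>Z\<close> in that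
  degree.\<close>

definition indep_forms :: "nat \<Rightarrow> (nat \<Rightarrow> ('k::field, 'n::finite) mpoly) \<Rightarrow> ('k ^ 'n) set set \<Rightarrow> bool" where
  "indep_forms N F Z \<longleftrightarrow>
     (\<forall>c. vanishes_on (\<Sum>i<N. scaled (c i) (F i)) Z \<longrightarrow> (\<forall>i<N. c i = 0))"

lemma homogeneous_combination:
  assumes "\<And>i. form d (F i)"
  shows "homogeneous (\<Sum>i\<in>A. scaled (c i) (F i))"
  unfolding homogeneous_iff_form using assms by (intro exI[of _ d] form_sum form_scaled)

text \<open>A coordinate that is nonzero at a point of \<open>Z\<close> where \<open>f\<close> does
  not vanish fills up the degree and keeps the value there nonzero.\<close>

lemma raise_degree:
  fixes f :: "('k::field, 'n::finite) mpoly"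
  assumes "form e f" "vanishes_on f Y" "\<not> vanishes_on f Z" "Z \<subseteq> proj UNIV" "e \<le> E"
  obtains f' where "form E f'" "vanishes_on f' Y" "\<not> vanishes_on f' Z"
proof -
  obtain l where l: "l \<in> Z" "\<not> vanishes_on f {l}" using assms(3) by (auto simp: vanishes_on_def)
  have "l \<in> proj UNIV" using l(1) assms(4) by blast
  then obtain v where v: "v \<noteq> 0" "l = vec.span {v}" by (rule proj_point)
  obtain j where j: "v $ j \<noteq> 0" using v(1) by (auto simp: vec_eq_iff)
  have hom: "homogeneous f" using assms(1) homogeneous_iff_form by blast
  have form: "form E (f * coord_pow j (E - e))"
    using form_mult[OF assms(1) form_coord_pow[of "E - e" j]] assms(5) by simp
  moreover have "vanishes_on (f * coord_pow j (E - e)) Y"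
    using assms(2) by (simp add: vanishes_on_def mpoly_eval_mult)
  moreover have "\<not> vanishes_on (f * coord_pow j (E - e)) {l}"
    using l(2) v(2) j vanishes_on_span[OF hom] vanishes_on_span[of "f * coord_pow j (E - e)" v] form
    by (auto simp: homogeneous_iff_form mpoly_eval_mult)
  then have "\<not> vanishes_on (f * coord_pow j (E - e)) Z"
    using l(1) vanishes_on_mono by blast
  ultimately show ?thesis by (rule that)
qed

lemma sum_lessThan_plus:
  fixes f :: "nat \<Rightarrow> 'a::comm_monoid_add"
  shows "(\<Sum>i<a + b. f i) = (\<Sum>i<a. f i) + (\<Sum>i<b. f (a + i))"
  by (induction b) (simp_all add: add.assoc)

text \<open>A relation restricted to \<open>Y\<close> loses its second half, since \<open>f\<close>
  vanishes there, so the coefficients of \<open>G\<close> are zero. What remains is \<open>f\<close>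
  times a combination of \<open>H\<close>, and irreducibility of \<open>Z\<close> cancels
  \<open>f\<close>.\<close>

lemma indep_forms_join:
  assumes irr: "irreducible_in zariski Z" and YZ: "Y \<subseteq> Z"
    and G: "indep_forms a G Y"
    and H: "indep_forms b H Z" "\<And>i. form d (H i)"
    and f: "homogeneous f" "vanishes_on f Y" "\<not> vanishes_on f Z"
  shows "indep_forms (a + b) (\<lambda>i. if i < a then G i else f * H (i - a)) Z"
  unfolding indep_forms_def
proof (intro allI impI)
  fix c i
  let ?P = "\<Sum>i<a. scaled (c i) (G i)" and ?Q = "\<Sum>i<b. scaled (c (a + i)) (H i)"
  assume "vanishes_on (\<Sum>i<a + b. scaled (c i) (if i < a then G i else f * H (i - a))) Z" and i: "i < a + b"
  moreover have "mpoly_eval (\<Sum>i<a + b. scaled (c i) (if i < a then G i else f * H (i - a))) x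
      = mpoly_eval ?P x + mpoly_eval f x * mpoly_eval ?Q x" for x
    by (simp add: sum_lessThan_plus mpoly_eval_add mpoly_eval_sum mpoly_eval_mult sum_distrib_left mult.left_commute)
  ultimately have PQ: "mpoly_eval ?P x + mpoly_eval f x * mpoly_eval ?Q x = 0" if "l \<in> Z" "x \<in> l" for l x
    using that by (simp add: vanishes_on_def)
  have "vanishes_on ?P Y"
    unfolding vanishes_on_def
  proof (intro ballI)
    fix l x assume "l \<in> Y" "x \<in> l"
    then show "mpoly_eval ?P x = 0"
      using PQ[of l x] f(2) YZ by (auto simp: vanishes_on_def)
  qed
  then have c0: "c j = 0" if "j < a" for j using G that by (simp add: indep_forms_def)
  then have "mpoly_eval ?P x = 0" for x by (simp add: mpoly_eval_sum)
  then have "vanishes_on (f * ?Q) Z"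
    using PQ by (simp add: vanishes_on_def mpoly_eval_mult)
  moreover have "homogeneous ?Q"
    using H(2) by (rule homogeneous_combination)
  ultimately have "vanishes_on ?Q Z" using irreducible_vanishes_mult[OF irr f(1)] f(3) by blast
  then have "c (a + j) = 0" if "j < b" for j
    using H(1)[unfolded indep_forms_def, rule_format, of "\<lambda>j. c (a + j)"] that by blast
  from this[of "i - a"] show "c i = 0" using c0[of i] i by (cases "i < a") auto
qed

text \<open>An inner induction on \<open>q\<close> joins forms independent on the next smaller
  member with a separating form times the family for \<open>q\<close>. \<open>E0\<close> dominates
  the degrees of the separating forms of all links, and every larger \<open>E\<close> works, so the
  smaller member can be used with the same \<open>E\<close>.\<close>

lemma chain_below_indep_forms:
  fixes Z :: "('k::field ^ 'n::finite) set set"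
  assumes "chain_below m Z"
  shows "\<exists>E0. \<forall>E\<ge>E0. \<forall>q. \<exists>F. (\<forall>i. form (q * E) (F i)) \<and> indep_forms ((q + m) choose m) F Z"
  using assms
proof (induction m arbitrary: Z)
  case 0
  then have Z: "Z \<noteq> {}" "Z \<subseteq> proj UNIV" by (auto simp: irreducible_in_def)
  then obtain l where l: "l \<in> Z" "l \<in> proj UNIV" by blast
  obtain v where "v \<noteq> 0" "l = vec.span {v}" using l(2) by (rule proj_point)
  note v = l(1) this
  then obtain j where j: "v $ j \<noteq> 0" by (auto simp: vec_eq_iff)
  have vl: "v \<in> l" using v by (simp add: vec.span_base)
  have "indep_forms 1 (\<lambda>i. coord_pow j d) Z" for d
    unfolding indep_forms_def
  proof (intro allI impI)
    fix c :: "nat \<Rightarrow> 'k" and i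
    assume "vanishes_on (\<Sum>i<1. scaled (c i) (coord_pow j d)) Z" and i: "i < (1::nat)"
    then have "mpoly_eval (\<Sum>i<1. scaled (c i) (coord_pow j d)) v = 0"
      using v(1) vl unfolding vanishes_on_def by blast
    then show "c i = 0" using i j by simp
  qed
  then have "(\<forall>i. form d (coord_pow j d)) \<and> indep_forms (q + 0 choose 0) (\<lambda>i. coord_pow j d) Z" for q d
    by simp
  then show ?case by (intro exI[of _ 0] allI impI exI[of _ "\<lambda>_. coord_pow j _"])
next
  case (Suc m)
  then obtain Y where Y: "Y \<subset> Z" "chain_below m Y" by auto
  from Suc.prems have Z: "irreducible_in zariski Z" "Z \<subseteq> proj UNIV" "Z \<noteq> {}"
    by (auto simp: irreducible_in_def)
  from Suc.IH[OF Y(2)] obtain E0 where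
    E0: "\<And>E q. E \<ge> E0 \<Longrightarrow> \<exists>F. (\<forall>i. form (q * E) (F i)) \<and> indep_forms ((q + m) choose m) F Y" by blast
  obtain l where l: "l \<in> Z" "l \<notin> Y" using Y(1) by blast
  obtain f where f: "homogeneous f" "vanishes_on f Y" "\<not> vanishes_on f {l}"
    using zariski_closed_separate[of Y l] chain_belowD[OF Y(2)] l Z(2) by blast
  then obtain e where e: "form e f" by (auto simp: homogeneous_iff_form)
  have nf: "\<not> vanishes_on f Z" using f(3) l(1) vanishes_on_mono by blast
  show ?case
  proof (intro exI[of _ "max E0 e"] allI impI)
    fix E q assume E: "E \<ge> max E0 e"
    obtain f' where f': "form E f'" "vanishes_on f' Y" "\<not> vanishes_on f' Z"
      using raise_degree[OF e f(2) nf Z(2), of E] E by auto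
    have hom: "homogeneous f'" using f'(1) homogeneous_iff_form by blast
    show "\<exists>F. (\<forall>i. form (q * E) (F i)) \<and> indep_forms ((q + Suc m) choose Suc m) F Z"
    proof (induction q)
      case 0
      \<comment> \<open>In degree 0 the binomial coefficient is 1 and the constant 1 suffices; it is
        written as a zeroth power, so the variable is arbitrary.\<close>
      obtain l where "l \<in> Z" using Z by blast
      moreover then have "0 \<in> l" using Z(2) by (auto simp: proj_def vec.subspace_0)
      ultimately have "indep_forms 1 (\<lambda>i. coord_pow undefined 0) Z"
        unfolding indep_forms_def vanishes_on_def by fastforce
      moreover have "form (0 * E) (coord_pow undefined 0 :: ('k, 'n) mpoly)" by simp
      ultimately have "(\<forall>i::nat. form (0 * E) (coord_pow undefined 0 :: ('k, 'n) mpoly)) \<and>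
          indep_forms (0 + Suc m choose Suc m) (\<lambda>i. coord_pow undefined 0) Z" by simp
      then show ?case by (intro exI[of _ "\<lambda>_. coord_pow undefined 0"])
    next
      case (Suc q)
      then obtain H where H: "\<And>i. form (q * E) (H i)" "indep_forms ((q + Suc m) choose Suc m) H Z" by blast
      obtain G where G: "\<And>i. form (Suc q * E) (G i)" "indep_forms ((Suc q + m) choose m) G Y"
        using E0[of E "Suc q"] E by auto
      have "indep_forms ((Suc q + m choose m) + (q + Suc m choose Suc m))
          (\<lambda>i. if i < (Suc q + m choose m) then G i else f' * H (i - (Suc q + m choose m))) Z"
        by (rule indep_forms_join[OF Z(1) _ G(2) H(2) H(1) hom f'(2,3)]) (use Y in auto)
      \<comment> \<open>Pascal's rule.\<close>
      moreover have "(Suc q + m choose m) + (q + Suc m choose Suc m) = Suc q + Suc m choose Suc m"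
        by simp
      moreover have "form (Suc q * E) (if i < (Suc q + m choose m) then G i else f' * H (i - (Suc q + m choose m)))" for i
        using G(1)[of i] form_mult[OF f'(1) H(1)] by simp
      ultimately show ?case by (intro exI conjI allI) simp_all
    qed
  qed
qed

section \<open>Upper bound for the Hilbert function from a parametrization\<close>

section \<open>Counting monomial functions\<close>

text \<open>Gaussian elimination, one equation of \<open>B\<close> at a time.\<close>

lemma homogeneous_system_solution:
  fixes M :: "'a \<Rightarrow> 'b \<Rightarrow> 'k::field"
  assumes "finite B" "finite A" "card B < card A"
  shows "\<exists>d. (\<exists>a\<in>A. d a \<noteq> 0) \<and> (\<forall>b\<in>B. (\<Sum>a\<in>A. d a * M a b) = 0)"
  using assms
proof (induction B arbitrary: A M rule: finite_induct)
  case empty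
  then obtain a where "a \<in> A" by (metis card.empty card_gt_0_iff ex_in_conv)
  then show ?case by (intro exI[of _ "\<lambda>_. 1"]) auto
next
  case (insert b B)
  show ?case
  proof (cases "\<forall>a\<in>A. M a b = 0")
    case True
    have "card B < card A" using insert by simp
    from insert.IH[OF insert.prems(1) this, of M] True show ?thesis by auto
  next
    case False
    then obtain a0 where a0: "a0 \<in> A" "M a0 b \<noteq> 0" by blast
    define A' where "A' = A - {a0}"
    have A': "finite A'" "a0 \<notin> A'" "A = insert a0 A'" using a0 insert.prems by (auto simp: A'_def)
    have "card B < card A'" using insert A' by simp
    \<comment> \<open>Equation \<open>b\<close> eliminates the unknown \<open>a0\<close> from the
      others; \<open>s\<close> below is the value it then forces on \<open>a0\<close>.\<close>
    from insert.IH[OF A'(1) this, of "\<lambda>a b'. M a b' - M a b / M a0 b * M a0 b'"]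
    obtain d a1 where d: "a1 \<in> A'" "d a1 \<noteq> 0"
      "\<And>b'. b' \<in> B \<Longrightarrow> (\<Sum>a\<in>A'. d a * (M a b' - M a b / M a0 b * M a0 b')) = 0" by blast
    define s where "s = - (\<Sum>a\<in>A'. d a * M a b) / M a0 b"
    let ?d = "d(a0 := s)"
    have sum: "(\<Sum>a\<in>A. ?d a * M a b') = s * M a0 b' + (\<Sum>a\<in>A'. d a * M a b')" for b'
    proof -
      have "(\<Sum>a\<in>A'. ?d a * M a b') = (\<Sum>a\<in>A'. d a * M a b')"
        using A'(2) by (intro sum.cong) auto
      then show ?thesis using A' by simp
    qed
    have "(\<Sum>a\<in>A. ?d a * M a b') = 0" if "b' \<in> B" for b'
    proof -
      have "(\<Sum>a\<in>A'. d a * (M a b' - M a b / M a0 b * M a0 b')) =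
         (\<Sum>a\<in>A'. d a * M a b') - (\<Sum>a\<in>A'. d a * M a b) / M a0 b * M a0 b'"
        by (simp add: sum_subtractf sum_divide_distrib sum_distrib_right right_diff_distrib mult.assoc)
      then show ?thesis unfolding sum using d(3)[OF that] by (simp add: s_def)
    qed
    moreover have "(\<Sum>a\<in>A. ?d a * M a b) = 0" unfolding sum using a0 by (simp add: s_def)
    moreover have "?d a1 \<noteq> 0" "a1 \<in> A" using d A' by auto
    ultimately show ?thesis
      by (intro exI[of _ ?d] conjI bexI[of "\<lambda>a. ?d a \<noteq> 0" a1]) (auto simp del: fun_upd_apply)
  qed
qed

text \<open>After multiplication by the factorial, the binomial coefficient is (q + 1) ... (q + m),
  a product of \<open>m\<close> factors that are at least \<open>q + 1\<close>.\<close>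

lemma power_le_fact_binomial: "(q + 1) ^ m \<le> fact m * ((q + m) choose m)"
proof (induction m)
  case (Suc m)
  have "(q + 1) ^ Suc m \<le> (q + m + 1) * (fact m * ((q + m) choose m))"
    using mult_mono[of "q + 1" "q + m + 1", OF _ Suc] by simp
  also have "\<dots> = fact m * (Suc (q + m) * ((q + m) choose m))"
    by (simp add: algebra_simps)
  also have "\<dots> = fact (Suc m) * ((q + Suc m) choose Suc m)"
    unfolding Suc_times_binomial_eq by (simp add: algebra_simps)
  finally show ?case .
qed simp

definition monomials_of_degree :: "nat \<Rightarrow> ('n::finite \<Rightarrow>\<^sub>0 nat) set" where
  "monomials_of_degree d = {m. (\<Sum>i\<in>UNIV. Poly_Mapping.lookup m i) = d}"

definition mono_eval :: "('n::finite \<Rightarrow>\<^sub>0 nat) \<Rightarrow> 'k::field ^ 'n \<Rightarrow> 'k" where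
  "mono_eval m x = (\<Prod>i\<in>UNIV. (x $ i) ^ Poly_Mapping.lookup m i)"

lemma lookup_le_degree: "m \<in> monomials_of_degree d \<Longrightarrow> Poly_Mapping.lookup m i \<le> d"
  using member_le_sum[of i UNIV "Poly_Mapping.lookup m"] by (auto simp: monomials_of_degree_def)

lemma finite_monomials_of_degree [simp]:
  "finite (monomials_of_degree d :: ('n::finite \<Rightarrow>\<^sub>0 nat) set)"
proof -
  have "Poly_Mapping.lookup ` monomials_of_degree d \<subseteq> (UNIV :: 'n set) \<rightarrow>\<^sub>E {..d}"
    using lookup_le_degree by fastforce
  then have "finite (Poly_Mapping.lookup ` (monomials_of_degree d :: ('n \<Rightarrow>\<^sub>0 nat) set))"
    by (rule finite_subset) (intro finite_PiE; simp)
  then show ?thesis by (rule finite_imageD) (simp add: inj_on_def lookup_inject)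
qed

lemma card_image_le_card_image:
  assumes "finite (g ` S)" "\<And>x y. x \<in> S \<Longrightarrow> y \<in> S \<Longrightarrow> g x = g y \<Longrightarrow> f x = f y"
  shows "card (f ` S) \<le> card (g ` S)"
proof -
  have "f x = f (inv_into S g (g x))" if "x \<in> S" for x
    using that assms(2)[of x "inv_into S g (g x)"] by (simp add: f_inv_into_f inv_into_into)
  then have "f ` S = (\<lambda>y. f (inv_into S g y)) ` g ` S" by (auto simp: image_image)
  then show ?thesis using card_image_le[OF assms(1)] by metis
qed

text \<open>One exponent is determined by the degree and the others; this accounts for the dimension
  \<open>CARD('n) - 1\<close> of projective space.\<close>

lemma card_monomials_of_degree:
  "card (monomials_of_degree d :: ('n::finite \<Rightarrow>\<^sub>0 nat) set) \<le> (d + 1) ^ (CARD('n) - 1)"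
proof -
  define i0 :: 'n where "i0 = undefined"
  let ?S = "monomials_of_degree d :: ('n \<Rightarrow>\<^sub>0 nat) set"
  let ?g = "\<lambda>m. restrict (Poly_Mapping.lookup m) (UNIV - {i0})"
  have sub: "?g ` ?S \<subseteq> (UNIV - {i0}) \<rightarrow>\<^sub>E {..d}"
    unfolding image_subset_iff restrict_PiE_iff by (simp add: lookup_le_degree)
  have fin: "finite ((UNIV - {i0}) \<rightarrow>\<^sub>E {..d})" by (intro finite_PiE) auto
  have "card (id ` ?S) \<le> card (?g ` ?S)"
  proof (rule card_image_le_card_image)
    fix x y assume xy: "x \<in> ?S" "y \<in> ?S" "?g x = ?g y"
    have eq: "Poly_Mapping.lookup x i = Poly_Mapping.lookup y i" if "i \<noteq> i0" for i
      using fun_cong[OF xy(3), of i] that by simp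
    have "(\<Sum>i\<in>UNIV. Poly_Mapping.lookup z i) = Poly_Mapping.lookup z i0 + (\<Sum>i\<in>UNIV - {i0}. Poly_Mapping.lookup z i)"
      for z :: "'n \<Rightarrow>\<^sub>0 nat" by (simp add: sum.remove)
    moreover have "(\<Sum>i\<in>UNIV - {i0}. Poly_Mapping.lookup x i) = (\<Sum>i\<in>UNIV - {i0}. Poly_Mapping.lookup y i)"
      by (rule sum.cong) (use eq in auto)
    ultimately have "Poly_Mapping.lookup x i0 = Poly_Mapping.lookup y i0"
      using xy by (simp add: monomials_of_degree_def)
    then show "id x = id y" using eq by (metis eq_id_iff poly_mapping_eqI)
  qed (use finite_subset[OF sub fin] in simp)
  also have "\<dots> \<le> card ((UNIV - {i0}) \<rightarrow>\<^sub>E {..d})" by (rule card_mono[OF fin sub])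
  also have "\<dots> = (d + 1) ^ (CARD('n) - 1)" by (simp add: card_PiE)
  finally show ?thesis by simp
qed

text \<open>A chain of length \<open>m\<close> makes the Hilbert function grow at least like the \<open>m\<close>-th power of the
  degree.\<close>

lemma chain_below_bound:
  fixes pt :: "'t \<Rightarrow> 'k::field ^ 'n::finite"
  assumes dense: "\<And>p. homogeneous p \<Longrightarrow> \<forall>t\<in>D. mpoly_eval p (pt t) = 0 \<Longrightarrow> vanishes_on p Y"
    and card: "\<And>d. card ((\<lambda>m. restrict (\<lambda>t. mono_eval m (pt t)) D) ` monomials_of_degree d) \<le> K * (d + 1) ^ s"
    and chain: "chain_below m Z" "Z \<subseteq> Y"
  shows "m \<le> s"
proof (rule ccontr)
  assume "\<not> m \<le> s"
  then have ms: "Suc s \<le> m" by simp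
  from chain_below_indep_forms[OF chain(1)] obtain E0 where
    E0: "\<forall>E\<ge>E0. \<forall>q. \<exists>F. (\<forall>i. form (q * E) (F i)) \<and> indep_forms ((q + m) choose m) F Z" by blast
  \<comment> \<open>The successor makes \<open>E\<close> positive, as the estimate of
    \<open>d + 1\<close> by \<open>E * (q + 1)\<close> requires.\<close>
  define E where "E = Suc E0"
  \<comment> \<open>The count will yield (q + 1) (q + 1)^s \<le> C (q + 1)^s with exactly this
    constant C, a contradiction once \<open>q\<close> is C.\<close>
  define q where "q = fact m * K * E ^ s"
  define d where "d = q * E"
  obtain F where F: "\<And>i. form d (F i)" "indep_forms ((q + m) choose m) F Z"
    using E0[rule_format, of E q] unfolding E_def d_def by auto
  let ?N = "(q + m) choose m"
  define \<psi> where "\<psi> = (\<lambda>m :: 'n \<Rightarrow>\<^sub>0 nat. restrict (\<lambda>t. mono_eval m (pt t)) D)"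
  let ?U = "\<psi> ` monomials_of_degree d"
  \<comment> \<open>Restricted to the points, every form is a combination of the functions in
    \<open>?U\<close>; more forms than functions would give a linear relation on
    \<open>Z\<close>.\<close>
  have "?N \<le> card ?U"
  proof (rule ccontr)
    assume less: "\<not> ?N \<le> card ?U"
    \<comment> \<open>The coefficient of \<open>u\<close> collects all monomials that restrict to
      the function \<open>u\<close>.\<close>
    define M where "M = (\<lambda>i u. \<Sum>m\<in>{m \<in> monomials_of_degree d. \<psi> m = u}. Poly_Mapping.lookup (F i) m)"
    have ev: "mpoly_eval (F i) (pt t) = (\<Sum>u\<in>?U. M i u * u t)" if t: "t \<in> D" for i t
    proof -
      have "Poly_Mapping.keys (F i) \<subseteq> monomials_of_degree d"
        using F(1)[of i] by (auto simp: form_def monomials_of_degree_def)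
      from mpoly_eval_superset[OF finite_monomials_of_degree this]
      have "mpoly_eval (F i) (pt t) = (\<Sum>m\<in>monomials_of_degree d. Poly_Mapping.lookup (F i) m * \<psi> m t)"
        using t by (simp add: \<psi>_def mono_eval_def)
      also have "\<dots> = (\<Sum>u\<in>?U. \<Sum>m\<in>{m \<in> monomials_of_degree d. \<psi> m = u}. Poly_Mapping.lookup (F i) m * \<psi> m t)"
        by (rule sum.image_gen) simp
      also have "\<dots> = (\<Sum>u\<in>?U. M i u * u t)"
        unfolding M_def sum_distrib_right by (intro sum.cong) auto
      finally show ?thesis .
    qed
    obtain c j where c: "j < ?N" "c j \<noteq> 0" "\<And>u. u \<in> ?U \<Longrightarrow> (\<Sum>i<?N. c i * M i u) = 0"
      using homogeneous_system_solution[of ?U "{..<?N}" M] less by auto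
    let ?p = "\<Sum>i<?N. scaled (c i) (F i)"
    have "homogeneous ?p" using F(1) by (rule homogeneous_combination)
    moreover have "mpoly_eval ?p (pt t) = 0" if t: "t \<in> D" for t
    proof -
      have "mpoly_eval ?p (pt t) = (\<Sum>i<?N. \<Sum>u\<in>?U. c i * M i u * u t)"
        by (simp add: mpoly_eval_sum ev[OF t] sum_distrib_left mult.assoc)
      also have "\<dots> = (\<Sum>u\<in>?U. (\<Sum>i<?N. c i * M i u) * u t)"
        by (subst sum.swap) (simp add: sum_distrib_right)
      also have "\<dots> = 0" using c(3) by simp
      finally show ?thesis .
    qed
    ultimately have "vanishes_on ?p Z" using dense chain(2) vanishes_on_mono by blast
    then show False using F(2) c(1,2) unfolding indep_forms_def by blast
  qed
  also have "\<dots> \<le> K * (d + 1) ^ s" using card[of d] by (simp add: \<psi>_def)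
  also have "\<dots> \<le> K * (E * (q + 1)) ^ s"
    by (intro mult_left_mono power_mono) (auto simp: d_def E_def algebra_simps)
  also have "\<dots> = K * E ^ s * (q + 1) ^ s" by (simp only: power_mult_distrib mult.assoc)
  finally have N: "?N \<le> K * E ^ s * (q + 1) ^ s" .
  have "(q + 1) * (q + 1) ^ s \<le> (q + 1) ^ m"
    using power_increasing[OF ms, of "q + 1"] by simp
  also have "\<dots> \<le> fact m * ?N" by (rule power_le_fact_binomial)
  also have "\<dots> \<le> q * (q + 1) ^ s" using N unfolding q_def by (simp add: mult.assoc)
  finally show False by simp
qed

lemma chain_below_proj_space:
  fixes Z :: "('k::field ^ 'n::finite) set set"
  assumes "chain_below m Z"
  shows "m \<le> CARD('n) - 1"
proof (rule chain_below_bound[where pt = id and D = UNIV and K = 1 and Y = UNIV])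
  fix d
  have "card ((\<lambda>m. restrict (\<lambda>t :: 'k ^ 'n. mono_eval m (id t)) UNIV) ` monomials_of_degree d)
      \<le> card (monomials_of_degree d :: ('n \<Rightarrow>\<^sub>0 nat) set)"
    by (rule card_image_le) simp
  also note card_monomials_of_degree
  finally show "card ((\<lambda>m. restrict (\<lambda>t :: 'k ^ 'n. mono_eval m (id t)) UNIV) ` monomials_of_degree d)
      \<le> 1 * (d + 1) ^ (CARD('n) - 1)" by simp
next
  show "chain_below m Z" "Z \<subseteq> UNIV" using assms by auto
qed (simp add: vanishes_on_def)

section \<open>Irreducibility along rational curves, and the dimension of linear subspaces\<close>

section \<open>Linear subspaces\<close>

text \<open>If every element were a root of \<open>q\<close>, then \<open>q + 1\<close> would have
  no root.\<close>

lemma infinite_alg_closed_field: "infinite (UNIV :: 'k::alg_closed_field set)"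
proof
  assume fin: "finite (UNIV :: 'k set)"
  define q where "q = (\<Prod>a\<in>(UNIV :: 'k set). [:- a, 1:])"
  have "degree q = card (UNIV :: 'k set)"
    unfolding q_def by (subst degree_prod_eq_sum_degree) auto
  then have "degree q > 0" using fin by (simp add: finite_UNIV_card_ge_0)
  then have "degree (q + 1) > 0" by (simp add: degree_add_eq_left)
  then obtain x where "poly (q + 1) x = 0" using alg_closed_imp_poly_has_root by blast
  moreover have "poly q x = 0" using fin by (simp add: q_def poly_prod prod_zero_iff)
  ultimately show False by simp
qed

lemma poly_nonroot:
  fixes P :: "'k::field poly"
  assumes "infinite (UNIV :: 'k set)" "P \<noteq> 0"
  obtains s where "poly P s \<noteq> 0"
proof -
  have "{s. poly P s = 0} \<noteq> UNIV" using assms poly_roots_finite[of P] by auto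
  then show ?thesis using that by blast
qed

lemma mpoly_eval_path:
  fixes u :: "'n::finite \<Rightarrow> 'k::field poly"
  obtains P where "\<And>s. poly P s = mpoly_eval p (\<chi> i. poly (u i) s)"
proof
  fix s
  show "poly (\<Sum>m\<in>Poly_Mapping.keys p. smult (Poly_Mapping.lookup p m)
      (\<Prod>i\<in>UNIV. u i ^ Poly_Mapping.lookup m i)) s = mpoly_eval p (\<chi> i. poly (u i) s)"
    by (simp add: mpoly_eval_def poly_sum poly_prod poly_power)
qed

text \<open>Here \<open>u\<close> is a rational curve through the two points, and \<open>R\<close> cuts out the finitely many
  parameters at which it may leave the set.\<close>

lemma irreducible_in_zariski_paths:
  fixes pt :: "'t \<Rightarrow> 'k::field ^ 'n::finite"
  assumes inf: "infinite (UNIV :: 'k set)"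
    and D: "D \<noteq> {}" "\<And>t. t \<in> D \<Longrightarrow> pt t \<noteq> 0"
    and path: "\<And>t t'. t \<in> D \<Longrightarrow> t' \<in> D \<Longrightarrow> \<exists>(u :: 'n \<Rightarrow> 'k poly) R. R \<noteq> 0 \<and>
       (\<chi> i. poly (u i) 0) = pt t \<and> (\<chi> i. poly (u i) 1) = pt t' \<and>
       (\<forall>s. poly R s \<noteq> 0 \<longrightarrow> (\<exists>t''\<in>D. pt t'' = (\<chi> i. poly (u i) s)))"
  shows "irreducible_in zariski {vec.span {pt t} |t. t \<in> D}" (is "irreducible_in _ ?S")
proof (rule irreducible_in_zariskiI)
  show "?S \<subseteq> proj UNIV" using D span_singleton_proj by blast
  show "?S \<noteq> {}" using D by blast
  fix p q :: "('k, 'n) mpoly"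
  assume hom: "homogeneous p" "homogeneous q" and nv: "\<not> vanishes_on p ?S" "\<not> vanishes_on q ?S"
  obtain t t' where t: "t \<in> D" "mpoly_eval p (pt t) \<noteq> 0" "t' \<in> D" "mpoly_eval q (pt t') \<noteq> 0"
    using nv vanishes_on_image_span hom by blast
  obtain u :: "'n \<Rightarrow> 'k poly" and R where R: "R \<noteq> 0" "(\<chi> i. poly (u i) 0) = pt t" "(\<chi> i. poly (u i) 1) = pt t'"
    "\<And>s. poly R s \<noteq> 0 \<Longrightarrow> \<exists>t''\<in>D. pt t'' = (\<chi> i. poly (u i) s)"
    using path[OF t(1,3)] by blast
  obtain P where P: "\<And>s. poly P s = mpoly_eval p (\<chi> i. poly (u i) s)" using mpoly_eval_path[where p = p] by blast
  obtain Q where Q: "\<And>s. poly Q s = mpoly_eval q (\<chi> i. poly (u i) s)" using mpoly_eval_path[where p = q] by blast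
  have "P \<noteq> 0" using P[of 0] R(2) t(2) by auto
  moreover have "Q \<noteq> 0" using Q[of 1] R(3) t(4) by auto
  \<comment> \<open>Over an infinite field one parameter avoids the zeros of all three factors and
    gives a point of the set where neither \<open>p\<close> nor \<open>q\<close> vanishes.\<close>
  ultimately have "P * Q * R \<noteq> 0" using R(1) by simp
  then obtain s where "poly (P * Q * R) s \<noteq> 0" using poly_nonroot[OF inf] by blast
  then have s: "poly P s \<noteq> 0" "poly Q s \<noteq> 0" "poly R s \<noteq> 0" by auto
  obtain t'' where "t'' \<in> D" "pt t'' = (\<chi> i. poly (u i) s)" using R(4)[OF s(3)] by blast
  then have "t'' \<in> D" "mpoly_eval (p * q) (pt t'') \<noteq> 0"
    using s P Q by (auto simp: mpoly_eval_mult)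
  then show "\<not> vanishes_on (p * q) ?S"
    using vanishes_on_image_span[OF homogeneous_mult[OF hom]] by blast
qed

lemma proj_eq_spans:
  assumes "vec.subspace W"
  shows "proj W = {vec.span {x} |x. x \<in> W - {0}}"
proof (intro set_eqI iffI)
  fix l assume "l \<in> proj W"
  then obtain v where "v \<noteq> 0" "v \<in> W" "l = vec.span {v}" by (rule proj_point)
  then show "l \<in> {vec.span {x} |x. x \<in> W - {0}}" by auto
next
  fix l assume "l \<in> {vec.span {x} |x. x \<in> W - {0}}"
  then show "l \<in> proj W"
    using vec.span_minimal[of "{_}" W] assms by (auto simp: proj_def)
qed

lemma proj_mono: "W \<subseteq> W' \<Longrightarrow> proj W \<subseteq> proj W'"
  by (auto simp: proj_def)

lemma proj_strict_mono:
  assumes "W \<subset> W'" "vec.subspace W" "vec.subspace W'"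
  shows "proj W \<subset> proj W'"
proof -
  obtain x where x: "x \<in> W'" "x \<notin> W" using assms by blast
  then have "x \<noteq> 0" using vec.subspace_0[OF assms(2)] by auto
  then have "vec.span {x} \<in> proj W'" using x assms(3) by (auto simp: proj_eq_spans)
  moreover have "vec.span {x} \<notin> proj W"
    using x vec.span_base[of x "{x}"] by (auto simp: proj_def)
  ultimately show ?thesis using proj_mono[of W W'] assms(1) by blast
qed

lemma irreducible_in_zariski_proj:
  fixes W :: "('k::field ^ 'n::finite) set"
  assumes inf: "infinite (UNIV :: 'k set)" and W: "vec.subspace W" "vec.dim W > 0"
  shows "irreducible_in zariski (proj W)"
  unfolding proj_eq_spans[OF W(1)]
proof (rule irreducible_in_zariski_paths[OF inf])
  show "W - {0} \<noteq> {}" using W(2) by (metis Diff_eq_empty_iff vec.dim_eq_0 less_numeral_extra(3))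
  fix x y assume xy: "x \<in> W - {0}" "y \<in> W - {0}"
  \<comment> \<open>The curve is the straight line from \<open>x\<close> to \<open>y\<close>. Its
    coordinate \<open>j\<close> is not the zero polynomial, and outside the roots of that polynomial
    the point is not the zero vector.\<close>
  obtain j where j: "x $ j \<noteq> 0" using xy by (auto simp: vec_eq_iff)
  let ?u = "\<lambda>i. [:x $ i, y $ i - x $ i:]"
  show "\<exists>(u :: 'n \<Rightarrow> 'k poly) R. R \<noteq> 0 \<and>
       (\<chi> i. poly (u i) 0) = x \<and> (\<chi> i. poly (u i) 1) = y \<and>
       (\<forall>s. poly R s \<noteq> 0 \<longrightarrow> (\<exists>z\<in>W - {0}. z = (\<chi> i. poly (u i) s)))"
  proof (intro exI[of _ ?u] exI[of _ "?u j"] conjI allI impI)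
    fix s assume s: "poly (?u j) s \<noteq> 0"
    have "(\<chi> i. poly (?u i) s) = x + s *s (y - x)" by (simp add: vec_eq_iff right_diff_distrib)
    moreover have "x + s *s (y - x) \<in> W"
      using xy W(1) by (intro vec.subspace_add vec.subspace_scale vec.subspace_diff) auto
    moreover have "(\<chi> i. poly (?u i) s) \<noteq> 0" using s by (auto simp: vec_eq_iff)
    ultimately show "\<exists>z\<in>W - {0}. z = (\<chi> i. poly (?u i) s)" by auto
  qed (use j in \<open>auto simp: vec_eq_iff\<close>)
qed auto

text \<open>An endomorphism \<open>g\<close> that kills \<open>W\<close> and fixes \<open>x\<close>
  has the wanted functional as one of its rows, at a coordinate where \<open>x\<close> is
  nonzero.\<close>

lemma linear_form_separate:
  fixes W :: "('k::field ^ 'n::finite) set"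
  assumes W: "vec.subspace W" and x: "x \<notin> W"
  obtains c where "\<And>y. y \<in> W \<Longrightarrow> (\<Sum>i\<in>UNIV. c i * y $ i) = 0" "(\<Sum>i\<in>UNIV. c i * x $ i) \<noteq> 0"
proof -
  obtain B where B: "B \<subseteq> W" "vec.independent B" "W \<subseteq> vec.span B" "card B = vec.dim W"
    by (rule vec.basis_exists)
  have "vec.span B = W" using B W vec.span_minimal by blast
  then have ind: "vec.independent (insert x B)" using x B(2) by (simp add: vec.independent_insertI)
  obtain g where g: "Vector_Spaces.linear (*s) (*s) g" "\<forall>y\<in>insert x B. g y = (if y = x then x else 0)"
    using vec.linear_independent_extend[OF ind, of "\<lambda>y. if y = x then x else 0"] by blast
  have xB: "x \<notin> B" using x B by auto
  have x0: "x \<noteq> 0" using x vec.subspace_0[OF W] by auto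
  then obtain j where j: "x $ j \<noteq> 0" by (auto simp: vec_eq_iff)
  have gW: "g y = 0" if "y \<in> W" for y
    by (rule vec.linear_eq_0_on_span[OF g(1), of B]) (use g xB B that in auto)
  have "(\<Sum>i\<in>UNIV. matrix g $ j $ i * y $ i) = g y $ j" for y
    using matrix_works[OF g(1), of y] by (simp add: matrix_vector_mult_def vec_eq_iff)
  then show ?thesis using that[of "\<lambda>i. matrix g $ j $ i"] gW g(2) j by simp
qed

lemma zariski_closed_proj:
  fixes W :: "('k::field ^ 'n::finite) set"
  assumes W: "vec.subspace W"
  shows "zariski_closed (proj W)"
proof -
  define S where "S = {linear_form c |c :: 'n \<Rightarrow> 'k. \<forall>y\<in>W. (\<Sum>i\<in>UNIV. c i * y $ i) = 0}"
  have "proj W = vanishing S"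
  proof (intro set_eqI iffI)
    fix l assume "l \<in> proj W"
    then show "l \<in> vanishing S" by (auto simp: proj_def vanishing_def S_def)
  next
    fix l assume l: "l \<in> vanishing S"
    then have lP: "l \<in> proj UNIV" by (simp add: vanishing_def)
    have "x \<in> W" if "x \<in> l" for x
    proof (rule ccontr)
      assume "x \<notin> W"
      then obtain c where c: "\<And>y. y \<in> W \<Longrightarrow> (\<Sum>i\<in>UNIV. c i * y $ i) = 0" "(\<Sum>i\<in>UNIV. c i * x $ i) \<noteq> 0"
        using linear_form_separate[OF W] by blast
      then have "linear_form c \<in> S" by (auto simp: S_def)
      then have "mpoly_eval (linear_form c) x = 0" using l that by (auto simp: vanishing_def)
      then show False using c(2) by simp
    qed
    then show "l \<in> proj W" using lP by (auto simp: proj_def)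
  qed
  moreover have "zariski_closed (vanishing S)"
    by (rule zariski_closed_vanishing) (auto simp: S_def)
  ultimately show ?thesis by simp
qed

text \<open>The chain is a complete flag of \<open>W\<close>; its smallest member is a
  point.\<close>

lemma chain_below_proj:
  fixes W :: "('k::field ^ 'n::finite) set"
  assumes inf: "infinite (UNIV :: 'k set)" and W: "vec.subspace W" "vec.dim W = Suc m"
  shows "chain_below m (proj W)"
  using W
proof (induction m arbitrary: W)
  case 0
  then show ?case using zariski_closed_proj[of W] irreducible_in_zariski_proj[OF inf, of W] by simp
next
  case (Suc m)
  obtain W' where W': "vec.subspace W'" "W' \<subseteq> vec.span W" "vec.dim W' = Suc m"
    using vec.choose_subspace_of_subspace[of "Suc m" W] Suc.prems by auto
  have sub: "W' \<subseteq> W" using W'(2) Suc.prems(1) vec.span_eq_iff by blast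
  have "W' \<noteq> W" using W'(3) Suc.prems(2) by auto
  then have "proj W' \<subset> proj W" using proj_strict_mono[OF _ W'(1) Suc.prems(1)] sub by blast
  then show ?case
    using Suc.IH[OF W'(1,3)] zariski_closed_proj[OF Suc.prems(1)]
      irreducible_in_zariski_proj[OF inf Suc.prems(1)] Suc.prems(2)
    unfolding chain_below.simps by auto
qed

text \<open>Counting is done for the whole space only: a chain in \<open>proj W\<close> is prolonged
  upwards by \<open>j\<close> subspaces that contain \<open>W\<close>, and the long chain is
  bounded.\<close>

lemma chain_below_proj_le:
  fixes W :: "('k::field ^ 'n::finite) set"
  assumes inf: "infinite (UNIV :: 'k set)" and W: "vec.subspace W" "vec.dim W + j = CARD('n)"
    and Z: "chain_below m Z" "Z \<subseteq> proj W"
  shows "m + j < CARD('n)"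
  using W Z
proof (induction j arbitrary: W m Z)
  case 0
  have "0 < CARD('n)" by simp
  then show ?case using chain_below_proj_space[OF "0.prems"(3)] by linarith
next
  case (Suc j)
  have "W \<noteq> UNIV" using Suc.prems(2) by (auto simp: card_cart_basis)
  then obtain x where x: "x \<notin> W" by blast
  define W' where "W' = vec.span (insert x W)"
  have W': "vec.subspace W'" "vec.dim W' + j = CARD('n)"
    using Suc.prems(1,2) x unfolding W'_def by (simp_all add: vec.dim_insert vec.span_eq_iff[THEN iffD2])
  have "x \<in> W'" "W \<subseteq> W'" by (auto simp: W'_def intro: vec.span_base)
  then have "proj W \<subset> proj W'" using proj_strict_mono[OF _ Suc.prems(1) W'(1)] x by blast
  then have "Z \<subset> proj W'" using Suc.prems(4) by blast
  moreover have "vec.dim W' > 0"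
    using \<open>x \<in> W'\<close> x vec.subspace_0[OF Suc.prems(1)] by (metis gr0I singletonD subsetD vec.dim_eq_0)
  ultimately have "chain_below (Suc m) (proj W')"
    using zariski_closed_proj[OF W'(1)] irreducible_in_zariski_proj[OF inf W'(1)] Suc.prems(3)
    unfolding chain_below.simps by blast
  from Suc.IH[OF W' this] show ?case by simp
qed

lemma zdim_proj:
  fixes W :: "('k::field ^ 'n::finite) set"
  assumes inf: "infinite (UNIV :: 'k set)" and W: "vec.subspace W"
  shows "zdim (proj W) = ereal (real (vec.dim W) - 1)"
proof (cases "vec.dim W")
  case 0
  \<comment> \<open>Here \<open>proj W\<close> is empty, and its dimension -1 is what the formula
    gives.\<close>
  then have "W \<subseteq> {0}" by simp
  then have "proj W = {}" using proj_eq_spans[OF W] by auto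
  then show ?thesis using 0 by (simp add: zdim_empty one_ereal_def)
next
  case (Suc m)
  note chain = chain_below_proj[OF inf W Suc]
  have "vec.dim W \<le> CARD('n)" using vec.dim_subset_UNIV[of W] by (simp add: vec.dimension_def card_cart_basis)
  then have "vec.dim W + (CARD('n) - vec.dim W) = CARD('n)" by simp
  from chain_below_proj_le[OF inf W this] have "k \<le> m" if "chain_below k Z" "Z \<subseteq> proj W" for k Z
    using that Suc by fastforce
  moreover have "proj W \<noteq> {}" using chain_belowD[OF chain] by (auto simp: irreducible_in_def)
  ultimately have "zdim (proj W) \<le> ereal (real m)"
    using zdim_le zariski_closed_proj[OF W] by blast
  moreover have "zdim (proj W) \<ge> ereal (real m)"
    using zdim_ge[OF zariski_closed_proj[OF W] chain] by simp
  ultimately show ?thesis using Suc by simp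
qed

section \<open>Orbits through the coordinate points of faces, and their irreducibility\<close>

section \<open>Torus orbits of coordinate faces\<close>

text \<open>Natural exponents make the coordinates of an orbit polynomials in the torus parameters,
  so they can be followed along polynomial curves.\<close>

definition torus_mono :: "nat \<Rightarrow> (nat \<Rightarrow> nat) \<Rightarrow> (nat \<Rightarrow> 'k::field) \<Rightarrow> 'k" where
  "torus_mono r e t = (\<Prod>j<r. t j ^ e j)"

text \<open>The torus translate of the vector with entries 1 on \<open>F\<close> and 0 elsewhere.
  For \<open>F = UNIV\<close> these vectors span the points of the original orbit; for a face
  \<open>F\<close> they are limits of such vectors up to scaling.\<close>

definition face_point :: "nat \<Rightarrow> ('n::finite \<Rightarrow> nat \<Rightarrow> nat) \<Rightarrow> 'n set \<Rightarrow> (nat \<Rightarrow> 'k::field) \<Rightarrow> 'k ^ 'n" where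
  "face_point r a F t = (\<chi> i. if i \<in> F then torus_mono r (a i) t else 0)"

text \<open>Unlike in \<open>torus\<close>, the values at indices from \<open>r\<close> on are
  unconstrained, so new parameters can be written down coordinate by coordinate.\<close>

definition torus_points :: "nat \<Rightarrow> (nat \<Rightarrow> 'k::field) set" where
  "torus_points r = {t. \<forall>j<r. t j \<noteq> 0}"

definition face_orbit :: "nat \<Rightarrow> ('n::finite \<Rightarrow> nat \<Rightarrow> nat) \<Rightarrow> 'n set \<Rightarrow> ('k::field ^ 'n) set set" where
  "face_orbit r a F = {vec.span {face_point r a F t} |t. t \<in> torus_points r}"

definition face_closure :: "nat \<Rightarrow> ('n::finite \<Rightarrow> nat \<Rightarrow> nat) \<Rightarrow> 'n set \<Rightarrow> ('k::field ^ 'n) set set" where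
  "face_closure r a F = zariski closure_of face_orbit r a F"

lemma torus_mono_nonzero: "t \<in> torus_points r \<Longrightarrow> torus_mono r e t \<noteq> 0"
  by (simp add: torus_mono_def torus_points_def)

lemma face_point_nonzero:
  assumes "F \<noteq> {}" "t \<in> torus_points r"
  shows "face_point r a F t \<noteq> 0"
proof -
  obtain i where "i \<in> F" using assms(1) by blast
  then have "face_point r a F t $ i \<noteq> 0" using torus_mono_nonzero[OF assms(2)] by (simp add: face_point_def)
  then show ?thesis by auto
qed

lemma face_orbit_subset: "F \<noteq> {} \<Longrightarrow> face_orbit r a F \<subseteq> proj UNIV"
  unfolding face_orbit_def using span_singleton_proj[OF face_point_nonzero] by blast

lemma zariski_closed_face_closure: "zariski_closed (face_closure r a F)"
  using closedin_closure_of[of zariski "face_orbit r a F"] unfolding face_closure_def closedin_zariski .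

lemma vanishes_on_face_closure:
  assumes "F \<noteq> {}" "homogeneous p"
  shows "vanishes_on p (face_closure r a F) \<longleftrightarrow> (\<forall>t\<in>torus_points r. mpoly_eval p (face_point r a F t) = 0)"
  unfolding face_closure_def vanishes_on_closure_of[OF face_orbit_subset[OF assms(1)] assms(2)]
  unfolding face_orbit_def by (rule vanishes_on_image_span[OF assms(2)])

lemma irreducible_in_face_closure:
  fixes a :: "'n::finite \<Rightarrow> nat \<Rightarrow> nat"
  assumes inf: "infinite (UNIV :: 'k::field set)" and F: "F \<noteq> {}"
  shows "irreducible_in zariski (face_closure r a F :: ('k ^ 'n) set set)"
  unfolding face_closure_def face_orbit_def
proof (rule irreducible_in_closure_of, rule irreducible_in_zariski_paths[OF inf])
  show "torus_points r \<noteq> ({} :: (nat \<Rightarrow> 'k) set)"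
    by (auto simp: torus_points_def intro: exI[of _ "\<lambda>_. 1"])
  show "t \<in> torus_points r \<Longrightarrow> face_point r a F t \<noteq> 0" for t :: "nat \<Rightarrow> 'k"
    using F by (rule face_point_nonzero)
  fix t t' :: "nat \<Rightarrow> 'k" assume t: "t \<in> torus_points r" "t' \<in> torus_points r"
  \<comment> \<open>The segment from \<open>t\<close> to \<open>t'\<close> in the parameter space.
    It leaves the torus only where one of the first \<open>r\<close> coordinates vanishes, whence
    the product below as \<open>R\<close>.\<close>
  define \<gamma> where "\<gamma> = (\<lambda>j. [:t j, t' j - t j:])"
  define u where "u = (\<lambda>i. if i \<in> F then \<Prod>j<r. \<gamma> j ^ a i j else 0)"
  have u: "(\<chi> i. poly (u i) s) = face_point r a F (\<lambda>j. poly (\<gamma> j) s)" for s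
    by (auto simp: u_def face_point_def torus_mono_def poly_prod poly_power vec_eq_iff)
  have \<gamma>: "poly (\<gamma> j) 0 = t j" "poly (\<gamma> j) 1 = t' j" for j by (simp_all add: \<gamma>_def)
  show "\<exists>(u :: 'n \<Rightarrow> 'k poly) R. R \<noteq> 0 \<and> (\<chi> i. poly (u i) 0) = face_point r a F t \<and>
      (\<chi> i. poly (u i) 1) = face_point r a F t' \<and>
      (\<forall>s. poly R s \<noteq> 0 \<longrightarrow> (\<exists>t''\<in>torus_points r. face_point r a F t'' = (\<chi> i. poly (u i) s)))"
  proof (intro exI[of _ u] exI[of _ "\<Prod>j<r. \<gamma> j"] conjI allI impI)
    have "\<gamma> j \<noteq> 0" if "j < r" for j
      using t that \<gamma>(1)[of j] by (auto simp: torus_points_def)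
    then show "(\<Prod>j<r. \<gamma> j) \<noteq> 0" by (simp add: prod_zero_iff)
    fix s assume "poly (\<Prod>j<r. \<gamma> j) s \<noteq> 0"
    then have "(\<lambda>j. poly (\<gamma> j) s) \<in> torus_points r" by (simp add: poly_prod torus_points_def)
    then show "\<exists>t''\<in>torus_points r. face_point r a F t'' = (\<chi> i. poly (u i) s)" unfolding u by blast
  qed (simp_all only: u \<gamma>)
qed

section \<open>Affine functions, their integral multiples, and facets\<close>

section \<open>Affine functions on a set of weights\<close>

text \<open>The coordinate functions of the weights and, at index \<open>r\<close>, the constant 1.
  Extension by zero outside \<open>F\<close> keeps all faces in one vector space.\<close>

definition aff_col :: "nat \<Rightarrow> ('n::finite \<Rightarrow> nat \<Rightarrow> nat) \<Rightarrow> 'n set \<Rightarrow> nat \<Rightarrow> rat ^ 'n" where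
  "aff_col r a F j = (\<chi> i. if i \<in> F then if j < r then of_nat (a i j) else 1 else 0)"

text \<open>Its dimension exceeds by one the dimension of the affine span of the weights in
  \<open>F\<close>.\<close>

definition aff :: "nat \<Rightarrow> ('n::finite \<Rightarrow> nat \<Rightarrow> nat) \<Rightarrow> 'n set \<Rightarrow> (rat ^ 'n) set" where
  "aff r a F = vec.span (aff_col r a F ` {..r})"

lemma subspace_aff: "vec.subspace (aff r a F)"
  by (simp add: aff_def)

lemma aff_col_in_aff: "j \<le> r \<Longrightarrow> aff_col r a F j \<in> aff r a F"
  by (simp add: aff_def vec.span_base)

lemma aff_induct:
  assumes "h \<in> aff r a F" "vec.subspace {h. P h}" "\<And>j. j \<le> r \<Longrightarrow> P (aff_col r a F j)"
  shows "P h"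
proof -
  have "aff r a F \<subseteq> {h. P h}"
    unfolding aff_def using assms(2,3) by (intro vec.span_minimal) auto
  then show ?thesis using assms(1) by blast
qed

lemma aff_support:
  assumes "h \<in> aff r a F" "i \<notin> F"
  shows "h $ i = 0"
  using assms(1)
  by (rule aff_induct) (use assms(2) in \<open>auto simp: vec.subspace_def aff_col_def\<close>)

definition restr :: "'n::finite set \<Rightarrow> rat ^ 'n \<Rightarrow> rat ^ 'n" where
  "restr G h = (\<chi> i. if i \<in> G then h $ i else 0)"

lemma aff_restr:
  assumes "G \<subseteq> F"
  shows "aff r a G = restr G ` aff r a F"
proof -
  have lin: "Vector_Spaces.linear (*s) (*s) (restr G)"
    by unfold_locales (auto simp: restr_def vec_eq_iff)
  have "aff_col r a G j = restr G (aff_col r a F j)" for j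
    using assms by (auto simp: aff_col_def restr_def vec_eq_iff)
  then have "aff_col r a G ` {..r} = restr G ` aff_col r a F ` {..r}"
    by (simp add: image_image)
  then show ?thesis unfolding aff_def using vec.linear_span_image[OF lin] by simp
qed

text \<open>Clearing denominators gives integers \<open>c j\<close>, the exponents of a
  one-parameter subgroup, and \<open>c r\<close>, the exponent of a common scaling factor.\<close>

lemma aff_integral:
  fixes h :: "rat ^ 'n::finite"
  assumes "h \<in> aff r a F"
  shows "\<exists>N>0. \<exists>c :: nat \<Rightarrow> int. \<forall>i\<in>F. of_int N * h $ i = of_int ((\<Sum>j<r. c j * int (a i j)) + c r)"
    (is "\<exists>N>0. \<exists>c. \<forall>i\<in>F. ?P N c h i")
  using assms
proof (rule aff_induct)
  show "vec.subspace {h. \<exists>N>0. \<exists>c. \<forall>i\<in>F. ?P N c h i}"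
    unfolding vec.subspace_def
  proof (intro conjI ballI allI; simp only: mem_Collect_eq)
    show "\<exists>N>0. \<exists>c. \<forall>i\<in>F. ?P N c 0 i"
      by (intro exI[of _ 1] exI[of _ "\<lambda>_. 0"] conjI) auto
  next
    fix h k assume "\<exists>N>0. \<exists>c. \<forall>i\<in>F. ?P N c h i" "\<exists>N>0. \<exists>c. \<forall>i\<in>F. ?P N c k i"
    then obtain N c M d where *: "N > 0" "M > 0" "\<And>i. i \<in> F \<Longrightarrow> ?P N c h i" "\<And>i. i \<in> F \<Longrightarrow> ?P M d k i"
      by blast
    have "?P (N * M) (\<lambda>j. M * c j + N * d j) (h + k) i" if i: "i \<in> F" for i
    proof -
      have "of_int (N * M) * (h + k) $ i = of_int M * (of_int N * h $ i) + of_int N * (of_int M * k $ i)"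
        by (simp add: algebra_simps)
      also have "\<dots> = of_int (M * ((\<Sum>j<r. c j * int (a i j)) + c r) + N * ((\<Sum>j<r. d j * int (a i j)) + d r))"
        unfolding *(3)[OF i] *(4)[OF i] by simp
      also have "M * ((\<Sum>j<r. c j * int (a i j)) + c r) + N * ((\<Sum>j<r. d j * int (a i j)) + d r) =
          (\<Sum>j<r. (M * c j + N * d j) * int (a i j)) + (M * c r + N * d r)"
        by (simp add: distrib_left distrib_right sum.distrib sum_distrib_left mult.assoc)
      finally show ?thesis .
    qed
    then show "\<exists>N>0. \<exists>c. \<forall>i\<in>F. ?P N c (h + k) i"
      using *(1,2) by (intro exI[of _ "N * M"] conjI exI[of _ "\<lambda>j. M * c j + N * d j"]) auto
  next
    fix q h assume "\<exists>N>0. \<exists>c. \<forall>i\<in>F. ?P N c h i"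
    then obtain N c where *: "N > 0" "\<And>i. i \<in> F \<Longrightarrow> ?P N c h i" by blast
    obtain x y where xy: "quotient_of q = (x, y)" by (cases "quotient_of q")
    have q: "q = of_int x / of_int y" "y > 0"
      using quotient_of_div[OF xy] quotient_of_denom_pos[OF xy] by auto
    have "?P (N * y) (\<lambda>j. x * c j) (q *s h) i" if i: "i \<in> F" for i
    proof -
      have "of_int (N * y) * (q *s h) $ i = of_int x * (of_int N * h $ i)"
        using q by simp
      also have "\<dots> = of_int (x * ((\<Sum>j<r. c j * int (a i j)) + c r))"
        unfolding *(2)[OF i] by simp
      also have "x * ((\<Sum>j<r. c j * int (a i j)) + c r) = (\<Sum>j<r. x * c j * int (a i j)) + x * c r"
        by (simp add: distrib_left sum_distrib_left mult.assoc)
      finally show ?thesis .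
    qed
    then show "\<exists>N>0. \<exists>c. \<forall>i\<in>F. ?P N c (q *s h) i"
      using *(1) q(2) by (intro exI[of _ "N * y"] conjI exI[of _ "\<lambda>j. x * c j"]) auto
  qed
next
  fix l assume l: "l \<le> r"
  have "(\<Sum>j<r. (if j = l then 1 else 0) * int (a i j)) = (if l < r then int (a i l) else 0)" for i
    by (subst if_distrib[of "\<lambda>x. x * _"]) (simp cong: if_cong)
  then show "\<exists>N>0. \<exists>c. \<forall>i\<in>F. ?P N c (aff_col r a F l) i"
    using l by (intro exI[of _ 1] conjI exI[of _ "\<lambda>j. if j = l then 1 else 0"]) (auto simp: aff_col_def)
qed

text \<open>A nonnegative \<open>g\<close> with a maximal number of zeros spans an extreme ray of
  the cone of nonnegative functions. The prescribed \<open>p\<close> stays off the facet, since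
  \<open>g\<close> is only varied in directions that vanish at \<open>p\<close>.\<close>

lemma facet_exists:
  fixes a :: "'n::finite \<Rightarrow> nat \<Rightarrow> nat"
  assumes p: "p \<in> F" and h0: "h0 \<in> aff r a F" "i0 \<in> F" "i1 \<in> F" "h0 $ i0 \<noteq> h0 $ i1"
  obtains g where "g \<in> aff r a F" "\<And>i. i \<in> F \<Longrightarrow> g $ i \<ge> 0" "g $ p > 0" "\<exists>i\<in>F. g $ i = 0"
    "\<And>h. h \<in> aff r a F \<Longrightarrow> (\<And>i. i \<in> F \<Longrightarrow> g $ i = 0 \<Longrightarrow> h $ i = 0) \<Longrightarrow> \<exists>c. h = c *s g"
proof -
  define Q where "Q = (\<lambda>g. g \<in> aff r a F \<and> (\<forall>i\<in>F. g $ i \<ge> 0) \<and> g $ p > 0 \<and> (\<exists>i\<in>F. g $ i = 0))"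
  note sub = subspace_aff[of r a F]
  have const: "c *s aff_col r a F r \<in> aff r a F" "i \<in> F \<Longrightarrow> aff_col r a F r $ i = 1" for c i
    using aff_col_in_aff[of r r a F] by (auto simp: vec.subspace_scale[OF sub] aff_col_def)
  have "\<exists>g. Q g"
  proof -
    have fin: "finite ((\<lambda>i. h0 $ i) ` F)" "(\<lambda>i. h0 $ i) ` F \<noteq> {}" using p by auto
    define lo hi where "lo = Min ((\<lambda>i. h0 $ i) ` F)" and "hi = Max ((\<lambda>i. h0 $ i) ` F)"
    have lo: "lo \<le> h0 $ i" "h0 $ i \<le> hi" if "i \<in> F" for i
      using that fin by (auto simp: lo_def hi_def)
    obtain il where il: "il \<in> F" "h0 $ il = lo" using Min_in[OF fin] by (auto simp: lo_def)
    obtain ih where ih: "ih \<in> F" "h0 $ ih = hi" using Max_in[OF fin] by (auto simp: hi_def)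
    \<comment> \<open>If \<open>p\<close> attains the minimum of \<open>h0\<close>, it does not
      attain the maximum, and the sign is reversed.\<close>
    show ?thesis
    proof (cases "h0 $ p > lo")
      case True
      then have "Q (h0 - lo *s aff_col r a F r)"
        using il lo p const h0(1) by (auto simp: Q_def vec.subspace_diff[OF sub] intro!: bexI[of _ il])
      then show ?thesis ..
    next
      case False
      then have "h0 $ p < hi" using lo(1)[OF h0(2)] lo(2)[OF h0(2)] lo(1)[OF h0(3)] lo(2)[OF h0(3)] h0(4) by linarith
      then have "Q (hi *s aff_col r a F r - h0)"
        using ih lo p const h0(1) by (auto simp: Q_def vec.subspace_diff[OF sub] intro!: bexI[of _ ih])
      then show ?thesis ..
    qed
  qed
  then obtain g0 where "Q g0" ..
  define zeros where "zeros = (\<lambda>g :: rat ^ 'n. card {i \<in> F. g $ i = 0})"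
  have "zeros g < Suc CARD('n)" for g
    unfolding zeros_def by (simp add: card_mono less_Suc_eq_le)
  then obtain g where g: "Q g" "\<And>k. Q k \<Longrightarrow> zeros k \<le> zeros g"
    using ex_has_greatest_nat[of Q g0 zeros] \<open>Q g0\<close> by blast
  have "\<exists>c. h = c *s g" if h: "h \<in> aff r a F" "\<And>i. i \<in> F \<Longrightarrow> g $ i = 0 \<Longrightarrow> h $ i = 0" for h
  proof (rule ccontr)
    assume no: "\<nexists>c. h = c *s g"
    \<comment> \<open>A multiple of \<open>g\<close> is subtracted to make the value at
      \<open>p\<close> zero; the result is nonzero because \<open>h\<close> is no multiple of
      \<open>g\<close>.\<close>
    define h1 where "h1 = h - (h $ p / g $ p) *s g"
    have h1: "h1 \<in> aff r a F" "h1 $ p = 0" "\<And>i. i \<in> F \<Longrightarrow> g $ i = 0 \<Longrightarrow> h1 $ i = 0" "h1 \<noteq> 0"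
      using h g(1) no by (auto simp: h1_def Q_def vec.subspace_diff[OF sub] vec.subspace_scale[OF sub])
    obtain i1 where "h1 $ i1 \<noteq> 0" using h1(4) by (auto simp: vec_eq_iff)
    then have i1: "h1 $ i1 \<noteq> 0" "i1 \<in> F" using aff_support[OF h1(1)] by auto
    define h2 where "h2 = sgn (h1 $ i1) *s h1"
    have h2: "h2 \<in> aff r a F" "h2 $ p = 0" "\<And>i. i \<in> F \<Longrightarrow> g $ i = 0 \<Longrightarrow> h2 $ i = 0" "h2 $ i1 > 0"
      using h1 i1 by (auto simp: h2_def vec.subspace_scale[OF sub] sgn_if)
    define I where "I = {i \<in> F. h2 $ i > 0}"
    \<comment> \<open>The largest step from \<open>g\<close> against \<open>h2\<close> that stays
      nonnegative. A new zero appears at \<open>i2\<close>, the old zeros remain and the value at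
      \<open>p\<close> is unchanged, contradicting maximality.\<close>
    define s where "s = Min ((\<lambda>i. g $ i / h2 $ i) ` I)"
    have I: "finite ((\<lambda>i. g $ i / h2 $ i) ` I)" "(\<lambda>i. g $ i / h2 $ i) ` I \<noteq> {}"
      using i1 h2(4) by (auto simp: I_def)
    obtain i2 where i2: "i2 \<in> I" "s = g $ i2 / h2 $ i2" using Min_in[OF I] by (auto simp: s_def)
    have gpos: "g $ i \<ge> 0" if "i \<in> F" for i using g(1) that by (auto simp: Q_def)
    have s0: "s \<ge> 0" using i2 gpos by (auto simp: I_def)
    define k where "k = g - s *s h2"
    have "k $ i \<ge> 0" if i: "i \<in> F" for i
    proof (cases "h2 $ i > 0")
      case True
      then have "s \<le> g $ i / h2 $ i" using i I(1) by (auto simp: s_def I_def)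
      then show ?thesis using True by (simp add: k_def pos_le_divide_eq)
    next
      case False
      then have "s * h2 $ i \<le> 0" using s0 by (simp add: mult_nonneg_nonpos)
      then show ?thesis using gpos[OF i] by (simp add: k_def)
    qed
    moreover have ki2: "k $ i2 = 0" "i2 \<in> F" "g $ i2 \<noteq> 0" using i2 h2(3)[of i2] by (auto simp: k_def I_def)
    ultimately have "Q k"
      using g(1) h2 by (auto simp: Q_def k_def vec.subspace_diff[OF sub] vec.subspace_scale[OF sub])
    moreover have "{i \<in> F. g $ i = 0} \<subset> {i \<in> F. k $ i = 0}"
      using ki2 h2(3) by (auto simp: k_def)
    then have "zeros g < zeros k" unfolding zeros_def by (intro psubset_card_mono) auto
    ultimately show False using g(2) by fastforce
  qed
  then show ?thesis using that g(1) unfolding Q_def by blast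
qed

text \<open>Rank-nullity for the restriction to the zeros of \<open>g\<close>: by \<open>ker\<close>
  only multiples of \<open>g\<close> restrict to zero, so \<open>g\<close> and lifts of a basis of
  the restrictions span.\<close>

lemma dim_aff_facet:
  assumes g: "g \<in> aff r a F"
    and ker: "\<And>h. h \<in> aff r a F \<Longrightarrow> (\<And>i. i \<in> F \<Longrightarrow> g $ i = 0 \<Longrightarrow> h $ i = 0) \<Longrightarrow> \<exists>c. h = c *s g"
  shows "vec.dim (aff r a F) \<le> Suc (vec.dim (aff r a {i \<in> F. g $ i = 0}))"
proof -
  let ?G = "{i \<in> F. g $ i = 0}"
  have img: "aff r a ?G = restr ?G ` aff r a F" by (rule aff_restr) auto
  note sub = subspace_aff[of r a F]
  obtain B where B: "B \<subseteq> aff r a ?G" "vec.independent B" "aff r a ?G \<subseteq> vec.span B" "card B = vec.dim (aff r a ?G)"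
    by (rule vec.basis_exists)
  have finB: "finite B" using B(2) by (rule vec.finiteI_independent)
  obtain C where C: "C \<subseteq> aff r a F" "B = restr ?G ` C" "card C = card B" "finite C"
  proof -
    obtain C where "C \<subseteq> aff r a F" "inj_on (restr ?G) C" "B = restr ?G ` C"
      using B(1) unfolding img subset_image_inj by blast
    then show ?thesis using that[of C] finB by (metis card_image finite_imageD)
  qed
  have lin: "Vector_Spaces.linear (*s) (*s) (restr ?G)"
    by unfold_locales (auto simp: restr_def vec_eq_iff)
  have "aff r a F \<subseteq> vec.span (insert g C)"
  proof
    fix h assume h: "h \<in> aff r a F"
    have "restr ?G h \<in> vec.span (restr ?G ` C)" using h img B(3) C(2) by blast
    then obtain h' where h': "h' \<in> vec.span C" "restr ?G h = restr ?G h'"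
      using vec.linear_span_image[OF lin, of C] by auto
    have "h' \<in> aff r a F" using h'(1) vec.span_minimal[OF C(1) sub] by blast
    then have "h - h' \<in> aff r a F" using h by (rule vec.subspace_diff[OF sub, rotated])
    moreover have "(h - h') $ i = 0" if "i \<in> F" "g $ i = 0" for i
      using arg_cong[OF h'(2), of "\<lambda>x. x $ i"] that by (simp add: restr_def)
    ultimately obtain c where "h - h' = c *s g" using ker by blast
    then have "h = c *s g + h'" by (simp add: algebra_simps)
    moreover have "h' \<in> vec.span (insert g C)" using h'(1) vec.span_mono[of C "insert g C"] by blast
    ultimately show "h \<in> vec.span (insert g C)"
      by (auto intro: vec.span_add vec.span_scale vec.span_base)
  qed
  then have "vec.dim (aff r a F) \<le> card (insert g C)" using C(4) by (intro vec.dim_le_card) auto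
  also have "\<dots> \<le> Suc (vec.dim (aff r a ?G))" using C B(4) by (simp add: card_insert_if)
  finally show ?thesis .
qed

text \<open>The functions that are constant on \<open>F\<close> form at most a line.\<close>

lemma aff_nonconstant:
  assumes "vec.dim (aff r a F) \<ge> 2"
  obtains h i j where "h \<in> aff r a F" "i \<in> F" "j \<in> F" "h $ i \<noteq> h $ j"
proof (rule ccontr)
  assume no: "\<not> thesis"
  have const: "h $ i = h $ j" if "h \<in> aff r a F" "i \<in> F" "j \<in> F" for h i j
    using no \<open>\<And>h i j. \<lbrakk>h \<in> aff r a F; i \<in> F; j \<in> F; h $ i \<noteq> h $ j\<rbrakk> \<Longrightarrow> thesis\<close> that by blast
  have "aff r a F \<subseteq> vec.span {aff_col r a F r}"
  proof
    fix h assume h: "h \<in> aff r a F"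
    obtain c where "\<forall>i\<in>F. h $ i = c" using const[OF h] by (cases "F = {}") blast+
    then have "h = c *s aff_col r a F r" using aff_support[OF h] by (auto simp: vec_eq_iff aff_col_def)
    then show "h \<in> vec.span {aff_col r a F r}" by (simp add: vec.span_base vec.span_scale)
  qed
  then have "vec.dim (aff r a F) \<le> card {aff_col r a F r}" by (intro vec.dim_le_card) auto
  then show False using assms by simp
qed

section \<open>Degeneration of orbits to faces, and chain lengths in orbit closures\<close>

lemma power_int_sum_exponent:
  fixes s :: "'k::field"
  assumes "s \<noteq> 0"
  shows "s powi (\<Sum>j\<in>A. f j) = (\<Prod>j\<in>A. s powi f j)"
  using assms by (induction A rule: infinite_finite_induct) (auto simp: power_int_add)

text \<open>A nonnegative affine function, made integral, is a one-parameter subgroup; letting its parameter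
  tend to \<open>0\<close> moves the orbit into the face where the function vanishes.\<close>

lemma face_closure_subset:
  fixes a :: "'n::finite \<Rightarrow> nat \<Rightarrow> nat"
  assumes inf: "infinite (UNIV :: 'k::field set)"
    and g: "g \<in> aff r a F" "\<And>i. i \<in> F \<Longrightarrow> g $ i \<ge> 0" "\<exists>i\<in>F. g $ i = 0"
  shows "face_closure r a {i \<in> F. g $ i = 0} \<subseteq> (face_closure r a F :: ('k ^ 'n) set set)"
proof -
  let ?G = "{i \<in> F. g $ i = 0}"
  have ne: "F \<noteq> {}" "?G \<noteq> {}" using g(3) by auto
  obtain N and c :: "nat \<Rightarrow> int" where N: "N > 0"
    and c: "\<And>i. i \<in> F \<Longrightarrow> of_int N * g $ i = of_int ((\<Sum>j<r. c j * int (a i j)) + c r)"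
    using aff_integral[OF g(1)] by blast
  \<comment> \<open>The values of an integral multiple of \<open>g\<close>: natural numbers that are
    zero exactly on the face.\<close>
  define e where "e = (\<lambda>i. nat ((\<Sum>j<r. c j * int (a i j)) + c r))"
  have e: "int (e i) = (\<Sum>j<r. c j * int (a i j)) + c r" "e i = 0 \<longleftrightarrow> g $ i = 0" if i: "i \<in> F" for i
  proof -
    have "of_int N * g $ i \<ge> 0" using g(2)[OF i] N by simp
    then have "(\<Sum>j<r. c j * int (a i j)) + c r \<ge> 0" unfolding c[OF i] of_int_0_le_iff .
    then show eq: "int (e i) = (\<Sum>j<r. c j * int (a i j)) + c r" by (simp add: e_def)
    have "g $ i = 0 \<longleftrightarrow> of_int N * g $ i = 0" using N by simp
    also have "\<dots> \<longleftrightarrow> int (e i) = 0" unfolding c[OF i] eq of_int_eq_0_iff ..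
    finally show "e i = 0 \<longleftrightarrow> g $ i = 0" by simp
  qed
  have "mpoly_eval p (face_point r a ?G t) = 0"
    if p: "homogeneous p" "vanishes_on p (face_closure r a F)" and t: "t \<in> torus_points r"
    for p :: "('k, 'n) mpoly" and t
  proof -
    \<comment> \<open>For nonzero \<open>s\<close> this curve is an orbit point scaled by
      \<open>s powi c r\<close>; at \<open>s = 0\<close> only the coordinates with exponent 0
      survive, which gives the point of the face.\<close>
    define u where "u = (\<lambda>i. if i \<in> F then smult (torus_mono r (a i) t) (monom 1 (e i)) else 0)"
    obtain P where P: "\<And>s. poly P s = mpoly_eval p (\<chi> i. poly (u i) s)"
      using mpoly_eval_path[where p = p] by blast
    have "poly P s = 0" if s: "s \<noteq> 0" for s
    proof -
      define t' where "t' = (\<lambda>j. t j * s powi c j)"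
      have t': "t' \<in> torus_points r" using t s by (auto simp: t'_def torus_points_def)
      have "(\<chi> i. poly (u i) s) = (s powi c r) *s face_point r a F t'"
      proof (rule vec_eq_iff[THEN iffD2], rule allI)
        fix i
        have "poly (u i) s = s powi c r * (if i \<in> F then torus_mono r (a i) t' else 0)"
        proof (cases "i \<in> F")
          case True
          have "torus_mono r (a i) t' = torus_mono r (a i) t * (\<Prod>j<r. s powi (c j * int (a i j)))"
            by (simp add: torus_mono_def t'_def power_mult_distrib prod.distrib power_int_mult)
          also have "(\<Prod>j<r. s powi (c j * int (a i j))) = s powi (\<Sum>j<r. c j * int (a i j))"
            by (rule power_int_sum_exponent[OF s, symmetric])
          finally have "s powi c r * torus_mono r (a i) t' =
              torus_mono r (a i) t * (s powi (\<Sum>j<r. c j * int (a i j)) * s powi c r)"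
            by (simp add: mult_ac)
          also have "s powi (\<Sum>j<r. c j * int (a i j)) * s powi c r = s ^ e i"
            using e(1)[OF True] s by (metis power_int_add power_int_of_nat)
          finally show ?thesis using True by (simp add: u_def poly_monom)
        qed (simp add: u_def)
        then show "(\<chi> i. poly (u i) s) $ i = ((s powi c r) *s face_point r a F t') $ i"
          by (simp add: face_point_def)
      qed
      moreover have "mpoly_eval p (face_point r a F t') = 0"
        using p t' vanishes_on_face_closure[OF ne(1) p(1)] by blast
      ultimately show ?thesis using P mpoly_eval_scale_eq_0[OF p(1)] by metis
    qed
    \<comment> \<open>The factor \<open>[:0, 1:]\<close> supplies the missing zero at
      \<open>s = 0\<close>. The product vanishes everywhere, so \<open>P\<close> is the zero
      polynomial, and its value at 0 is the claim.\<close>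
    then have "poly (P * [:0, 1:]) s = 0" for s by (cases "s = 0") auto
    then have "P * [:0, 1:] = 0" using poly_nonroot[OF inf] by metis
    then have "P = 0" by simp
    moreover have "(\<chi> i. poly (u i) 0) = face_point r a ?G t"
      using e(2) by (auto simp: vec_eq_iff u_def face_point_def poly_monom power_0_left)
    ultimately show ?thesis using P[of 0] by simp
  qed
  then have "vanishes_on p (face_closure r a ?G)" if "homogeneous p" "vanishes_on p (face_closure r a F)"
    for p :: "('k, 'n) mpoly"
    using that vanishes_on_face_closure[OF ne(2) that(1)] by blast
  moreover have "face_closure r a ?G \<subseteq> (proj UNIV :: ('k ^ 'n) set set)"
    using zariski_closed_subset zariski_closed_face_closure by blast
  moreover have "l \<in> face_closure r a F"
    if l: "l \<in> face_closure r a ?G" "l \<in> proj UNIV"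
      and van: "\<And>p :: ('k, 'n) mpoly. homogeneous p \<Longrightarrow> vanishes_on p (face_closure r a F) \<Longrightarrow> vanishes_on p (face_closure r a ?G)"
    for l :: "('k ^ 'n) set"
  proof (rule ccontr)
    assume "l \<notin> face_closure r a F"
    with zariski_closed_face_closure l(2) obtain p where
      p: "homogeneous p" "vanishes_on p (face_closure r a F)" "\<not> vanishes_on p {l}"
      by (rule zariski_closed_separate)
    then show False using vanishes_on_mono[OF van[OF p(1,2)], of "{l}"] l(1) by simp
  qed
  ultimately show ?thesis by (meson subsetD subsetI)
qed

lemma face_closure_coord_zero:
  fixes x :: "'k::field ^ 'n::finite"
  assumes "F \<noteq> {}" "i \<notin> F" "l \<in> face_closure r a F" "x \<in> l"
  shows "x $ i = 0"
proof -
  have "homogeneous (coord_pow i 1 :: ('k, 'n) mpoly)"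
    unfolding homogeneous_iff_form by (rule exI) (rule form_coord_pow)
  then have "vanishes_on (coord_pow i 1) (face_closure r a F :: ('k ^ 'n) set set)"
    unfolding vanishes_on_face_closure[OF assms(1) \<open>homogeneous (coord_pow i 1)\<close>]
    using assms(2) by (simp add: face_point_def)
  then show ?thesis using assms(3,4) by (auto simp: vanishes_on_def)
qed

text \<open>Passing to a facet costs at most one dimension of affine functions, so \<open>m\<close>
  steps are possible. The inclusions are strict because the facet closure lies in a coordinate
  hyperplane that misses the orbit of \<open>F\<close>.\<close>

lemma chain_below_face_closure:
  fixes a :: "'n::finite \<Rightarrow> nat \<Rightarrow> nat"
  assumes inf: "infinite (UNIV :: 'k::field set)" and "Suc m \<le> vec.dim (aff r a F)"
  shows "chain_below m (face_closure r a F :: ('k ^ 'n) set set)"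
  using assms(2)
proof (induction m arbitrary: F)
  have ne: "F \<noteq> {}" if "Suc m \<le> vec.dim (aff r a F)" for m F
  proof
    assume "F = {}"
    then have "aff r a F \<subseteq> {0}" using aff_support[of _ r a F] by (auto simp: vec_eq_iff)
    then have "vec.dim (aff r a F) = 0" by simp
    then show False using that by linarith
  qed
  {
    case 0
    show ?case using irreducible_in_face_closure[OF inf ne[OF 0]] zariski_closed_face_closure by auto
  next
    case (Suc m)
    then have "vec.dim (aff r a F) \<ge> 2" by simp
    then obtain h i j where h: "h \<in> aff r a F" "i \<in> F" "j \<in> F" "h $ i \<noteq> h $ j"
      by (rule aff_nonconstant)
    obtain g where g: "g \<in> aff r a F" "\<And>i'. i' \<in> F \<Longrightarrow> g $ i' \<ge> 0" "g $ i > 0" "\<exists>i\<in>F. g $ i = 0"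
      "\<And>h. h \<in> aff r a F \<Longrightarrow> (\<And>i. i \<in> F \<Longrightarrow> g $ i = 0 \<Longrightarrow> h $ i = 0) \<Longrightarrow> \<exists>c. h = c *s g"
      by (rule facet_exists[OF h(2) h]) blast
    let ?G = "{i \<in> F. g $ i = 0}"
    have "Suc m \<le> vec.dim (aff r a ?G)" using dim_aff_facet[OF g(1,5)] Suc.prems by auto
    then have "chain_below m (face_closure r a ?G :: ('k ^ 'n) set set)" by (rule Suc.IH)
    moreover have "face_closure r a ?G \<subset> (face_closure r a F :: ('k ^ 'n) set set)"
    proof -
      define t :: "nat \<Rightarrow> 'k" where "t = (\<lambda>_. 1)"
      have t: "t \<in> torus_points r" by (simp add: t_def torus_points_def)
      let ?x = "face_point r a F t"
      have "vec.span {?x} \<in> face_orbit r a F" using t by (auto simp: face_orbit_def)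
      then have "vec.span {?x} \<in> face_closure r a F"
        unfolding face_closure_def
        using closure_of_subset[of "face_orbit r a F" zariski] face_orbit_subset[OF ne[OF Suc.prems]] by auto
      moreover have "vec.span {?x} \<notin> face_closure r a ?G"
      proof
        assume "vec.span {?x} \<in> face_closure r a ?G"
        then have "?x $ i = 0"
          using face_closure_coord_zero[of ?G i "vec.span {?x}" r a ?x] g(3,4) vec.span_base by auto
        then show False using h(2) torus_mono_nonzero[OF t] by (simp add: face_point_def)
      qed
      ultimately show ?thesis using face_closure_subset[OF inf g(1,2,4)] by blast
    qed
    ultimately show ?case
      using irreducible_in_face_closure[OF inf ne[OF Suc.prems]] zariski_closed_face_closure
      unfolding chain_below.simps by blast
  }
qed

text \<open>On the orbit a monomial function is determined by its pairings with the columns, hence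
  with a basis \<open>B\<close> of their span. One pairing is the fixed degree and the others are
  natural numbers at most \<open>M * d\<close>, so the count grows with exponent
  \<open>card B - 1\<close>.\<close>

lemma chain_below_face_closure_bound:
  fixes a :: "'n::finite \<Rightarrow> nat \<Rightarrow> nat" and Z :: "('k::field ^ 'n) set set"
  assumes Z: "chain_below m Z" "Z \<subseteq> face_closure r a UNIV"
  shows "m < vec.dim (aff r a UNIV)"
proof -
  define one :: "rat ^ 'n" where "one = aff_col r a UNIV r"
  have "one \<noteq> 0" by (auto simp: one_def aff_col_def vec_eq_iff)
  then have "vec.independent {one}" by simp
  \<comment> \<open>The basis consists of columns, which makes the pairings natural numbers, and
    contains the constant 1, whose pairing is the degree.\<close>
  then obtain B where B: "{one} \<subseteq> B" "B \<subseteq> aff_col r a UNIV ` {..r}" "vec.independent B"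
      "aff_col r a UNIV ` {..r} \<subseteq> vec.span B"
    using vec.maximal_independent_subset_extend[of "{one}" "aff_col r a UNIV ` {..r}"] one_def by blast
  have finB: "finite B" using B(3) by (rule vec.finiteI_independent)
  have dim: "card B = vec.dim (aff r a UNIV)"
    unfolding aff_def vec.dim_span using B by (intro vec.basis_card_eq_dim)
  have "card B > 0" using B(1) finB by (auto simp: card_gt_0_iff)
  define s where "s = card B - 1"
  \<comment> \<open>The successor lets \<open>M\<close> also bound the entry 1 of the constant
    column.\<close>
  define M where "M = Suc (\<Sum>i\<in>UNIV. \<Sum>j<r. a i j)"
  have M: "a i j \<le> M" if "j < r" for i j
  proof -
    have "a i j \<le> (\<Sum>j<r. a i j)" using that by (intro member_le_sum) auto
    also have "\<dots> \<le> (\<Sum>i\<in>UNIV. \<Sum>j<r. a i j)" by (rule member_le_sum) auto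
    finally show ?thesis by (simp add: M_def)
  qed
  define pair where "pair = (\<lambda>m (h :: rat ^ 'n). \<Sum>i\<in>UNIV. of_nat (Poly_Mapping.lookup m i) * h $ i)"
  have pair_one: "pair m one = of_nat d" if "m \<in> monomials_of_degree d" for m d
    using that by (auto simp: pair_def one_def aff_col_def monomials_of_degree_def simp flip: of_nat_sum)
  have pair_range: "pair m b \<in> of_nat ` {..M * d}" if m: "m \<in> monomials_of_degree d" and b: "b \<in> B" for m d b
  proof -
    obtain j where j: "b = aff_col r a UNIV j" using b B(2) by blast
    let ?e = "\<lambda>i. if j < r then a i j else 1"
    have eq: "pair m b = of_nat (\<Sum>i\<in>UNIV. Poly_Mapping.lookup m i * ?e i)"
      unfolding pair_def j aff_col_def of_nat_sum by (rule sum.cong) auto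
    have "(\<Sum>i\<in>UNIV. Poly_Mapping.lookup m i * ?e i) \<le> M * d"
    proof -
      have "(\<Sum>i\<in>UNIV. Poly_Mapping.lookup m i * ?e i) \<le> (\<Sum>i\<in>UNIV. Poly_Mapping.lookup m i * M)"
        using M by (intro sum_mono mult_left_mono) (auto simp: M_def)
      also have "\<dots> = M * d" using m by (simp add: monomials_of_degree_def flip: sum_distrib_right)
      finally show ?thesis .
    qed
    then show ?thesis unfolding eq by (intro imageI) simp
  qed
  define f where "f = (\<lambda>m. restrict (\<lambda>t :: nat \<Rightarrow> 'k. mono_eval m (face_point r a UNIV t)) (torus_points r))"
  have bound: "card (f ` monomials_of_degree d) \<le> (M + 1) ^ s * (d + 1) ^ s" for d
  proof -
    let ?S = "monomials_of_degree d :: ('n \<Rightarrow>\<^sub>0 nat) set"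
    define \<tau> where "\<tau> = (\<lambda>m. restrict (pair m) (B - {one}))"
    let ?R = "(B - {one}) \<rightarrow>\<^sub>E (of_nat ` {..M * d} :: rat set)"
    have fin: "finite ?R" using finB by (intro finite_PiE) auto
    have sub: "\<tau> ` ?S \<subseteq> ?R"
      unfolding \<tau>_def image_subset_iff restrict_PiE_iff using pair_range by blast
    have "card (f ` ?S) \<le> card (\<tau> ` ?S)"
    proof (rule card_image_le_card_image)
      show "finite (\<tau> ` ?S)" using fin sub by (rule finite_subset[rotated])
      fix x y assume xy: "x \<in> ?S" "y \<in> ?S" "\<tau> x = \<tau> y"
      have "pair x b = pair y b" if "b \<in> B" for b
        using fun_cong[OF xy(3), of b] that pair_one[OF xy(1)] pair_one[OF xy(2)]
        by (cases "b = one") (auto simp: \<tau>_def)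
      moreover have "vec.subspace {h. pair x h = pair y h}"
        by (auto simp: vec.subspace_def pair_def distrib_left sum.distrib mult.left_commute simp flip: sum_distrib_left)
      \<comment> \<open>Equality of pairings is a linear condition, so it passes from the basis to
        all columns and gives equal exponents of each \<open>t j\<close>.\<close>
      ultimately have "vec.span B \<subseteq> {h. pair x h = pair y h}" by (intro vec.span_minimal) auto
      then have col: "pair x (aff_col r a UNIV j) = pair y (aff_col r a UNIV j)" if "j < r" for j
        using subsetD[OF B(4), of "aff_col r a UNIV j"] that by auto
      have exps: "(\<Sum>i\<in>UNIV. a i j * Poly_Mapping.lookup x i) = (\<Sum>i\<in>UNIV. a i j * Poly_Mapping.lookup y i)" if "j < r" for j
      proof -
        have "pair z (aff_col r a UNIV j) = of_nat (\<Sum>i\<in>UNIV. a i j * Poly_Mapping.lookup z i)" for z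
          using that by (simp add: pair_def aff_col_def mult.commute)
        then show ?thesis using col[OF that] by (simp only: of_nat_eq_iff)
      qed
      have "mono_eval z (face_point r a UNIV t) = (\<Prod>j<r. t j ^ (\<Sum>i\<in>UNIV. a i j * Poly_Mapping.lookup z i))"
        for z and t :: "nat \<Rightarrow> 'k"
      proof -
        have "mono_eval z (face_point r a UNIV t) = (\<Prod>i\<in>UNIV. \<Prod>j<r. t j ^ (a i j * Poly_Mapping.lookup z i))"
          by (simp add: mono_eval_def face_point_def torus_mono_def power_mult flip: prod_power_distrib)
        then show ?thesis by (subst (asm) prod.swap) (simp add: power_sum)
      qed
      then show "f x = f y" using exps by (simp add: f_def)
    qed
    also have "\<dots> \<le> card ?R" by (rule card_mono[OF fin sub])
    also have "\<dots> = card (of_nat ` {..M * d} :: rat set) ^ s"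
      using finB B(1) by (simp add: card_PiE s_def)
    also have "\<dots> \<le> (M * d + 1) ^ s"
      using card_image_le[of "{..M * d}" "of_nat :: nat \<Rightarrow> rat"] by (intro power_mono) auto
    also have "\<dots> \<le> ((M + 1) * (d + 1)) ^ s" by (intro power_mono) auto
    also have "\<dots> = (M + 1) ^ s * (d + 1) ^ s" by (rule power_mult_distrib)
    finally show ?thesis .
  qed
  have "m \<le> s"
    by (rule chain_below_bound[OF _ bound[unfolded f_def] Z]) (use vanishes_on_face_closure in blast)
  then show ?thesis using \<open>card B > 0\<close> dim by (simp add: s_def)
qed

section \<open>Translation to the given weights, and the case of the whole space\<close>

section \<open>Weights and the orbit closure\<close>

text \<open>The shift by \<open>M\<close> multiplies all coordinates by the same nonzero scalar,
  which leaves the projective point unchanged.\<close>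

lemma orbit_closure_eq_face_closure:
  fixes w :: "'n::finite \<Rightarrow> nat \<Rightarrow> int"
  assumes a: "\<And>i j. j < r \<Longrightarrow> int (a i j) = w i j + int M"
  shows "orbit_closure r w = (face_closure r a UNIV :: ('k::field ^ 'n) set set)"
proof -
  have act: "torus_act r w t (vec.span {\<chi> i. 1}) = vec.span {face_point r a UNIV t}"
    if t: "\<And>j. j < r \<Longrightarrow> t j \<noteq> 0" for t :: "nat \<Rightarrow> 'k"
  proof -
    have lin: "Vector_Spaces.linear (*s) (*s) (\<lambda>x :: 'k ^ 'n. \<chi> i. char_eval r (w i) t * x $ i)"
      by unfold_locales (auto simp: vec_eq_iff algebra_simps)
    define c where "c = (\<Prod>j<r. t j ^ M)"
    have c: "c \<noteq> 0" using t by (simp add: c_def)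
    have "char_eval r (w i) t * c = torus_mono r (a i) t" for i
    proof -
      have "t j powi w i j * t j ^ M = t j ^ a i j" if "j < r" for j
        using t[OF that] by (metis a[OF that] power_int_add power_int_of_nat)
      then show ?thesis by (simp add: char_eval_def c_def torus_mono_def flip: prod.distrib)
    qed
    then have "face_point r a UNIV t = c *s (\<chi> i. char_eval r (w i) t)"
      by (simp add: face_point_def vec_eq_iff mult.commute)
    then show ?thesis
      unfolding torus_act_def using vec.linear_span_image[OF lin, of "{\<chi> i. 1}"]
      by (simp add: span_singleton_scale[OF c])
  qed
  have "{torus_act r w t (vec.span {\<chi> i. 1}) |t. t \<in> torus r} = (face_orbit r a UNIV :: ('k ^ 'n) set set)"
  proof (intro set_eqI iffI)
    fix l :: "('k ^ 'n) set" assume "l \<in> {torus_act r w t (vec.span {\<chi> i. 1}) |t. t \<in> torus r}"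
    then obtain t where t: "t \<in> torus r" "l = torus_act r w t (vec.span {\<chi> i. 1})" by blast
    have "t j \<noteq> 0" if "j < r" for j using t(1) that by (auto simp: torus_def PiE_iff)
    then show "l \<in> face_orbit r a UNIV" using t(2) act by (auto simp: face_orbit_def torus_points_def)
  next
    fix l :: "('k ^ 'n) set" assume "l \<in> face_orbit r a UNIV"
    then obtain t where t: "t \<in> torus_points r" "l = vec.span {face_point r a UNIV t}" by (auto simp: face_orbit_def)
    \<comment> \<open>The elements of \<open>torus\<close> are extensional functions.\<close>
    let ?t = "restrict t {..<r}"
    have "?t \<in> torus r" using t(1) by (auto simp: torus_def torus_points_def)
    moreover have "face_point r a UNIV ?t = face_point r a UNIV t"
      by (simp add: face_point_def torus_mono_def)
    then have "l = torus_act r w ?t (vec.span {\<chi> i. 1})"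
      using t act[of ?t] by (simp add: torus_points_def)
    ultimately show "l \<in> {torus_act r w t (vec.span {\<chi> i. 1}) |t. t \<in> torus r}" by blast
  qed
  then show ?thesis by (simp add: orbit_closure_def face_closure_def)
qed

text \<open>An affine relation has coefficient sum zero, so it does not see the common shift by
  \<open>M\<close>.\<close>

lemma affinely_independent_iff_aff:
  fixes w :: "'n::finite \<Rightarrow> nat \<Rightarrow> int"
  assumes a: "\<And>i j. j < r \<Longrightarrow> int (a i j) = w i j + int M"
  shows "affinely_independent r w \<longleftrightarrow>
    (\<forall>c :: 'n \<Rightarrow> rat. (\<forall>h\<in>aff r a UNIV. (\<Sum>i\<in>UNIV. c i * h $ i) = 0) \<longrightarrow> (\<forall>i. c i = 0))"
proof -
  have "(\<Sum>i\<in>UNIV. c i) = 0 \<and> (\<forall>j<r. (\<Sum>i\<in>UNIV. c i * of_int (w i j)) = 0) \<longleftrightarrow>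
    (\<forall>h\<in>aff r a UNIV. (\<Sum>i\<in>UNIV. c i * h $ i) = 0)" (is "?L \<longleftrightarrow> ?R") for c :: "'n \<Rightarrow> rat"
  proof -
    have col: "(\<Sum>i\<in>UNIV. c i * aff_col r a UNIV j $ i) =
        (if j < r then (\<Sum>i\<in>UNIV. c i * of_int (w i j)) + of_nat M * (\<Sum>i\<in>UNIV. c i) else (\<Sum>i\<in>UNIV. c i))" for j
    proof (cases "j < r")
      case True
      have "of_nat (a i j) = (of_int (w i j) + of_nat M :: rat)" for i
        using arg_cong[OF a[OF True, of i], of "of_int :: int \<Rightarrow> rat"] by simp
      then show ?thesis using True by (simp add: aff_col_def distrib_left sum.distrib sum_distrib_left mult.commute)
    qed (simp add: aff_col_def)
    show ?thesis
    proof
      assume L: ?L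
      show ?R
      proof
        fix h assume "h \<in> aff r a UNIV"
        then show "(\<Sum>i\<in>UNIV. c i * h $ i) = 0"
        proof (rule aff_induct)
          show "vec.subspace {h :: rat ^ 'n. (\<Sum>i\<in>UNIV. c i * h $ i) = 0}"
            by (auto simp: vec.subspace_def distrib_left sum.distrib mult.left_commute simp flip: sum_distrib_left)
        qed (use L col in auto)
      qed
    next
      assume R: ?R
      have "(\<Sum>i\<in>UNIV. c i * aff_col r a UNIV j $ i) = 0" if "j \<le> r" for j
        using R aff_col_in_aff[OF that] by blast
      then have R': "(if j < r then (\<Sum>i\<in>UNIV. c i * of_int (w i j)) + of_nat M * (\<Sum>i\<in>UNIV. c i)
          else (\<Sum>i\<in>UNIV. c i)) = 0" if "j \<le> r" for j
        using that col by simp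
      have "(\<Sum>i\<in>UNIV. c i) = 0" using R'[of r] by simp
      moreover have "(\<Sum>i\<in>UNIV. c i * of_int (w i j)) = 0" if "j < r" for j
        using R'[of j] that calculation by simp
      ultimately show ?L by blast
    qed
  qed
  then show ?thesis unfolding affinely_independent_def by simp
qed

text \<open>Duality: a proper subspace is annihilated by a nonzero functional, found here by solving
  fewer equations than unknowns.\<close>

lemma dim_aff_full_iff:
  fixes a :: "'n::finite \<Rightarrow> nat \<Rightarrow> nat"
  shows "vec.dim (aff r a UNIV) = CARD('n) \<longleftrightarrow>
    (\<forall>c :: 'n \<Rightarrow> rat. (\<forall>h\<in>aff r a UNIV. (\<Sum>i\<in>UNIV. c i * h $ i) = 0) \<longrightarrow> (\<forall>i. c i = 0))"
    (is "?L \<longleftrightarrow> ?R")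
proof
  assume ?L
  then have "aff r a UNIV = UNIV"
    using vec.dim_eq_full[of "aff r a UNIV"] subspace_aff[of r a UNIV]
    by (simp add: vec.dimension_def card_cart_basis vec.span_eq_iff[THEN iffD2])
  show ?R
  proof (intro allI impI)
    fix c :: "'n \<Rightarrow> rat" and p assume c: "\<forall>h\<in>aff r a UNIV. (\<Sum>i\<in>UNIV. c i * h $ i) = 0"
    have "(\<Sum>i\<in>UNIV. c i * axis p 1 $ i) = 0" using c \<open>aff r a UNIV = UNIV\<close> by blast
    then show "c p = 0" by (simp add: axis_def if_distrib[of "\<lambda>x. _ * x"] cong: if_cong)
  qed
next
  assume R: ?R
  obtain B where B: "B \<subseteq> aff r a UNIV" "vec.independent B" "aff r a UNIV \<subseteq> vec.span B" "card B = vec.dim (aff r a UNIV)"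
    by (rule vec.basis_exists)
  have finB: "finite B" using B(2) by (rule vec.finiteI_independent)
  have "\<not> card B < CARD('n)"
  proof
    assume "card B < CARD('n)"
    then obtain c :: "'n \<Rightarrow> rat" and p where c: "c p \<noteq> 0" "\<And>b. b \<in> B \<Longrightarrow> (\<Sum>i\<in>UNIV. c i * b $ i) = 0"
      using homogeneous_system_solution[of B "UNIV :: 'n set" "\<lambda>i b. b $ i"] finB by auto
    have "vec.span B \<subseteq> {h. (\<Sum>i\<in>UNIV. c i * h $ i) = 0}"
      using c(2)
      by (intro vec.span_minimal) (auto simp: vec.subspace_def distrib_left sum.distrib mult.left_commute simp flip: sum_distrib_left)
    then show False using R B(3) c(1) by blast
  qed
  then show ?L using B(4) vec.dim_subset_UNIV[of "aff r a UNIV"] by (simp add: vec.dimension_def card_cart_basis)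
qed

text \<open>Both directions compare chain lengths. A proper closed subset with a chain of length
  \<open>CARD('n) - 1\<close> could be topped by the irreducible whole space, exceeding
  \<open>chain_below_proj_space\<close>.\<close>

lemma face_closure_eq_proj_iff:
  fixes a :: "'n::finite \<Rightarrow> nat \<Rightarrow> nat"
  assumes inf: "infinite (UNIV :: 'k::field set)"
  shows "(face_closure r a UNIV :: ('k ^ 'n) set set) = proj UNIV \<longleftrightarrow> vec.dim (aff r a UNIV) = CARD('n)"
proof
  have n: "CARD('n) = Suc (CARD('n) - 1)" by simp
  have dimU: "vec.dim (UNIV :: ('k ^ 'n) set) = CARD('n)" by (simp add: card_cart_basis)
  {
    assume X: "(face_closure r a UNIV :: ('k ^ 'n) set set) = proj UNIV"
    have "chain_below (CARD('n) - 1) (proj UNIV :: ('k ^ 'n) set set)"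
      using chain_below_proj[OF inf, of UNIV "CARD('n) - 1"] dimU n by simp
    from chain_below_face_closure_bound[OF this] X n have "CARD('n) \<le> vec.dim (aff r a UNIV)" by (metis Suc_leI order_refl)
    then show "vec.dim (aff r a UNIV) = CARD('n)"
      using vec.dim_subset_UNIV[of "aff r a UNIV"] by (simp add: vec.dimension_def card_cart_basis)
  next
    assume dim: "vec.dim (aff r a UNIV) = CARD('n)"
    let ?X = "face_closure r a UNIV :: ('k ^ 'n) set set"
    have chain: "chain_below (CARD('n) - 1) ?X" using chain_below_face_closure[OF inf, of "CARD('n) - 1" r a UNIV] dim n by simp
    have sub: "?X \<subseteq> proj UNIV" using zariski_closed_face_closure by (rule zariski_closed_subset)
    show "?X = proj UNIV"
    proof (rule ccontr)
      assume "?X \<noteq> proj UNIV"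
      then have "?X \<subset> proj UNIV" using sub by blast
      moreover have "irreducible_in zariski (proj UNIV :: ('k ^ 'n) set set)"
        by (rule irreducible_in_zariski_proj[OF inf]) (simp_all add: card_cart_basis)
      ultimately have "chain_below (Suc (CARD('n) - 1)) (proj UNIV :: ('k ^ 'n) set set)"
        using chain zariski_closed_proj[of "UNIV :: ('k ^ 'n) set"] vec.subspace_UNIV
        unfolding chain_below.simps by blast
      from chain_below_proj_space[OF this] n show False by simp
    qed
  }
qed

section \<open>The strong separation property and its failure for dependent weights\<close>

lemma strong_separation_proj:
  assumes inf: "infinite (UNIV :: 'k::field set)"
  shows "strong_separation (proj UNIV :: ('k ^ 'n::finite) set set)"
  unfolding strong_separation_def
proof (intro allI impI)
  fix W :: "('k ^ 'n) set" assume W: "vec.subspace W \<and> vec.dim W + 2 = CARD('n)"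
  then have "real (vec.dim W) + 2 = real CARD('n)" by (metis of_nat_add of_nat_numeral)
  moreover have "proj W \<inter> proj UNIV = proj W" by (auto simp: proj_def)
  ultimately show "codim_in (proj UNIV) (proj W \<inter> proj UNIV) = 2"
    using W by (simp add: codim_in_def zdim_proj[OF inf] card_cart_basis)
qed

text \<open>A single point is \<open>proj l\<close> for a line \<open>l\<close>, which is a chain of
  length 0.\<close>

lemma zdim_nonneg:
  fixes Y :: "('k::field ^ 'n::finite) set set"
  assumes inf: "infinite (UNIV :: 'k set)" and Y: "zariski_closed Y" "Y \<noteq> {}"
  shows "zdim Y \<ge> 0"
proof -
  obtain l where l: "l \<in> Y" using Y(2) by blast
  then have lP: "l \<in> proj UNIV" using zariski_closed_subset[OF Y(1)] by blast
  then obtain v where v: "v \<noteq> 0" "l = vec.span {v}" by (rule proj_point)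
  have sub: "vec.subspace l" "vec.dim l = Suc 0" using lP by (auto simp: proj_def)
  have "proj l \<subseteq> {l}"
    unfolding proj_eq_spans[OF sub(1)] using v span_singleton_scale
    by (fastforce simp: vec.span_singleton[of v])
  then have "ereal (real 0) \<le> zdim Y"
    using l by (intro zdim_ge[OF Y(1) chain_below_proj[OF inf sub]]) blast
  then show ?thesis by (simp add: zero_ereal_def)
qed

lemma coordinate_codim_2:
  assumes "i \<noteq> j"
  shows "vec.subspace {x :: 'k::field ^ 'n::finite. x $ i = 0 \<and> x $ j = 0}"
    and "vec.dim {x :: 'k::field ^ 'n::finite. x $ i = 0 \<and> x $ j = 0} + 2 = CARD('n)"
proof -
  show "vec.subspace {x :: 'k ^ 'n. x $ i = 0 \<and> x $ j = 0}" by (auto simp: vec.subspace_def)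
  have "{x :: 'k ^ 'n. x $ i = 0 \<and> x $ j = 0} = {x. \<forall>l. l \<notin> UNIV - {i, j} \<longrightarrow> x $ l = 0}" by auto
  then have "vec.dim {x :: 'k ^ 'n. x $ i = 0 \<and> x $ j = 0} = card (UNIV - {i, j})"
    by (simp only: dim_substandard_cart)
  moreover have "card (UNIV - {i, j}) = CARD('n) - 2" using assms by (simp add: card_Diff_subset)
  moreover have "card {i, j} \<le> CARD('n)" by (rule card_mono) auto
  ultimately show "vec.dim {x :: 'k ^ 'n. x $ i = 0 \<and> x $ j = 0} + 2 = CARD('n)" using assms by simp
qed

text \<open>It suffices to find one coordinate subspace of codimension 2 whose intersection with the
  orbit closure has codimension at most 1 there.\<close>

lemma not_strong_separation_face_closure:
  fixes a :: "'n::finite \<Rightarrow> nat \<Rightarrow> nat"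
  assumes inf: "infinite (UNIV :: 'k::field set)" and dim: "vec.dim (aff r a UNIV) \<noteq> CARD('n)"
  shows "\<not> strong_separation (face_closure r a UNIV :: ('k ^ 'n) set set)"
proof
  let ?X = "face_closure r a UNIV :: ('k ^ 'n) set set" and ?d = "vec.dim (aff r a UNIV)"
  let ?W = "\<lambda>i j. {x :: 'k ^ 'n. x $ i = 0 \<and> x $ j = 0}"
  assume ssp: "strong_separation ?X"
  have irr: "irreducible_in zariski ?X" by (rule irreducible_in_face_closure[OF inf]) simp
  have X: "zariski_closed ?X" "?X \<noteq> {}" using zariski_closed_face_closure irr by (auto simp: irreducible_in_def)
  have "chain_below 0 ?X" using irr X by simp
  from chain_below_face_closure_bound[OF this order_refl] have d: "?d \<ge> 1" by simp
  have upper: "zdim ?X \<le> ereal (real (?d - 1))"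
    using chain_below_face_closure_bound by (intro zdim_le[OF X]) fastforce
  have closed: "zariski_closed (proj (?W i j) \<inter> ?X)" if "i \<noteq> j" for i j
  proof -
    have "proj (?W i j) \<inter> ?X = proj UNIV \<inter> \<Inter>{proj (?W i j), ?X}"
      using zariski_closed_subset[OF X(1)] by auto
    also have "zariski_closed \<dots>"
      using zariski_closed_proj[OF coordinate_codim_2(1)[OF that]] X(1)
      by (intro zariski_closed_Inter) auto
    finally show ?thesis .
  qed
  \<comment> \<open>The lower bound is a difference of reals, so for \<open>?d = 1\<close> it is -1,
    the dimension of the empty set.\<close>
  have False if "i \<noteq> j" and lower: "zdim (proj (?W i j) \<inter> ?X) \<ge> ereal (real ?d - 2)" for i j
  proof -
    have "codim_in ?X (proj (?W i j) \<inter> ?X) = 2"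
      using ssp coordinate_codim_2[OF that(1)] unfolding strong_separation_def by blast
    moreover have "codim_in ?X (proj (?W i j) \<inter> ?X) \<le> ereal (real (?d - 1)) - ereal (real ?d - 2)"
      unfolding codim_in_def using upper lower by (rule ereal_minus_mono)
    moreover have "ereal (real (?d - 1)) - ereal (real ?d - 2) = 1" using d by (simp add: of_nat_diff one_ereal_def)
    ultimately show False by simp
  qed
  note contra = this
  have dn: "?d < CARD('n)"
    using dim vec.dim_subset_UNIV[of "aff r a UNIV"] by (simp add: vec.dimension_def card_cart_basis)
  show False
  proof (cases "?d = 1")
    \<comment> \<open>Here \<open>?X\<close> has dimension 0, and even an empty intersection has
      codimension only 1.\<close>
    case True
    have "\<exists>i j :: 'n. i \<noteq> j"
    proof (rule ccontr)
      assume "\<not> ?thesis"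
      then have "(UNIV :: 'n set) = {undefined}" by auto
      then have "CARD('n) = card {undefined :: 'n}" by (rule arg_cong)
      then show False using True dn by simp
    qed
    then obtain i j :: 'n where ij: "i \<noteq> j" by blast
    have "zdim (proj (?W i j) \<inter> ?X) \<ge> ereal (-1)"
    proof (cases "proj (?W i j) \<inter> ?X = {}")
      case False
      then have "zdim (proj (?W i j) \<inter> ?X) \<ge> 0"
        using zdim_nonneg[OF inf closed[OF ij]] by blast
      then show ?thesis by (rule order_trans[rotated]) simp
    qed (simp add: zdim_empty one_ereal_def)
    then show False using contra[OF ij] True by simp
  next
    case False
    then have d2: "?d \<ge> 2" using d by simp
    then obtain h i0 i1 where h: "h \<in> aff r a UNIV" "i0 \<in> UNIV" "i1 \<in> UNIV" "h $ i0 \<noteq> h $ i1"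
      by (rule aff_nonconstant)
    \<comment> \<open>A linear relation satisfied by all affine functions; the facet is chosen to
      miss an index \<open>p\<close> with nonzero coefficient in it.\<close>
    obtain c :: "'n \<Rightarrow> rat" and p where c: "\<forall>h\<in>aff r a UNIV. (\<Sum>i\<in>UNIV. c i * h $ i) = 0" "c p \<noteq> 0"
      using dim dim_aff_full_iff by blast
    obtain g where g: "g \<in> aff r a UNIV" "\<And>i. i \<in> UNIV \<Longrightarrow> g $ i \<ge> 0" "g $ p > 0" "\<exists>i\<in>UNIV. g $ i = 0"
      "\<And>h. h \<in> aff r a UNIV \<Longrightarrow> (\<And>i. i \<in> UNIV \<Longrightarrow> g $ i = 0 \<Longrightarrow> h $ i = 0) \<Longrightarrow> \<exists>c. h = c *s g"
      by (rule facet_exists[OF UNIV_I[of p] h]) blast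
    \<comment> \<open>A function \<open>g\<close> supported at \<open>p\<close> alone would violate
      the relation \<open>c\<close>.\<close>
    have "\<exists>q. q \<noteq> p \<and> g $ q \<noteq> 0"
    proof (rule ccontr)
      assume "\<not> ?thesis"
      then have "(\<Sum>i\<in>UNIV. c i * g $ i) = (\<Sum>i\<in>UNIV. if i = p then c p * g $ p else 0)"
        by (intro sum.cong) auto
      then show False using c g(1,3) by auto
    qed
    then obtain q where q: "q \<noteq> p" "g $ q \<noteq> 0" by blast
    let ?G = "{i \<in> UNIV. g $ i = 0}"
    have "?d \<le> Suc (vec.dim (aff r a ?G))" by (rule dim_aff_facet[OF g(1,5)])
    then have "Suc (?d - 2) \<le> vec.dim (aff r a ?G)" using d2 by linarith
    then have chain: "chain_below (?d - 2) (face_closure r a ?G :: ('k ^ 'n) set set)"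
      by (rule chain_below_face_closure[OF inf])
    have G: "?G \<noteq> {}" using g(4) by auto
    have "face_closure r a ?G \<subseteq> proj (?W q p)"
    proof
      fix l :: "('k ^ 'n) set" assume l: "l \<in> face_closure r a ?G"
      have "l \<in> proj UNIV" using l zariski_closed_subset[OF zariski_closed_face_closure] by blast
      moreover have "x $ q = 0 \<and> x $ p = 0" if "x \<in> l" for x
        using face_closure_coord_zero[OF G _ l that] q(2) g(3) by auto
      ultimately show "l \<in> proj (?W q p)" by (auto simp: proj_def)
    qed
    then have "zdim (proj (?W q p) \<inter> ?X) \<ge> ereal (real (?d - 2))"
      using face_closure_subset[OF inf g(1,2,4)] by (intro zdim_ge[OF closed[OF q(1)] chain]) blast
    then show False using contra[OF q(1)] d2 by (simp add: of_nat_diff)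
  qed
qed

theorem theorem5:
  fixes r :: nat
    and w :: "'n::finite \<Rightarrow> nat \<Rightarrow> int"
    and X :: "('k::alg_closed_field ^ 'n) set set"
  assumes "\<And>i. w i \<in> char_lattice r"
    and "X = orbit_closure r w"
  shows "(strong_separation X \<longleftrightarrow> X = proj UNIV) \<and>
         (X = proj UNIV \<longleftrightarrow> affinely_independent r w)"
proof -
  note inf = infinite_alg_closed_field[where 'k = 'k]
  \<comment> \<open>The total of all absolute values dominates each of them, so the shifted weights
    are nonnegative.\<close>
  define M where "M = nat (\<Sum>i\<in>UNIV. \<Sum>j<r. \<bar>w i j\<bar>)"
  define a where "a = (\<lambda>i j. nat (w i j + int M))"
  have a: "int (a i j) = w i j + int M" if "j < r" for i j
  proof -
    have "\<bar>w i j\<bar> \<le> (\<Sum>j<r. \<bar>w i j\<bar>)" using that by (intro member_le_sum) auto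
    also have "\<dots> \<le> (\<Sum>i\<in>UNIV. \<Sum>j<r. \<bar>w i j\<bar>)"
      by (rule member_le_sum) (auto intro: sum_nonneg)
    finally have "\<bar>w i j\<bar> \<le> int M" unfolding M_def by linarith
    then show ?thesis by (simp add: a_def)
  qed
  have X: "X = face_closure r a UNIV"
    unfolding assms(2) using a by (rule orbit_closure_eq_face_closure)
  have indep: "affinely_independent r w \<longleftrightarrow> vec.dim (aff r a UNIV) = CARD('n)"
    unfolding dim_aff_full_iff using a by (rule affinely_independent_iff_aff)
  have "X = proj UNIV \<longleftrightarrow> affinely_independent r w"
    unfolding X indep by (rule face_closure_eq_proj_iff[OF inf])
  moreover have "strong_separation X \<Longrightarrow> affinely_independent r w"
    unfolding X indep using not_strong_separation_face_closure[OF inf] by blast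
  moreover have "X = proj UNIV \<Longrightarrow> strong_separation X" using strong_separation_proj[OF inf] by simp
  ultimately show ?thesis by blast
qed

end
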